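(* Let $c\ge1$ be such that $c+1$ is a prime number or $c+1=4$. Let $G$ be a finite nilpotent group and $G_p$ its Sylow $p$-subgroup for a prime $p$. Then $\mathcal N_cM(G)_p\cong\mathcal N_cM(G_p)$.
   Context: $\mathcal N_c$ is the variety of nilpotent groups of class at most $c$. For a group $K$ with free presentation $1\to R\to F\to K\to1$, its Baer-invariant with respect to $\mathcal N_c$ is $\mathcal N_cM(K)=(R\cap\gamma_{c+1}(F))/[R,{}_cF]$, where $\gamma_{c+1}(F)$ is the $(c+1)$-st term of the lower central series and $[R,{}_cF]=[R,F,\dots,F]$ ($c$ copies of $F$); it is abelian, independent of the presentation up to isomorphism, and finite when $K$ is finite. For a finite abelian group $A$, $A_p$ denotes its Sylow $p$-subgroup. *)

theory Defs
  imports "HOL-Algebra.Algebra" "HOL-Computational_Algebra.Primes"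
begin

definition comm_subgroup :: "('a, 'b) monoid_scheme \<Rightarrow> 'a set \<Rightarrow> 'a set \<Rightarrow> 'a set" where
  "comm_subgroup G A B = generate G
     (\<Union>a\<in>A. \<Union>b\<in>B. {a \<otimes>\<^bsub>G\<^esub> b \<otimes>\<^bsub>G\<^esub> inv\<^bsub>G\<^esub> a \<otimes>\<^bsub>G\<^esub> inv\<^bsub>G\<^esub> b})"

primrec iter_comm :: "('a, 'b) monoid_scheme \<Rightarrow> 'a set \<Rightarrow> nat \<Rightarrow> 'a set" where
  "iter_comm G R 0 = R"
| "iter_comm G R (Suc n) = comm_subgroup G (iter_comm G R n) (carrier G)"

text \<open>Lower central series, shifted: lcs G n is gamma_(n+1)(G); so lcs G 0 = G.\<close>
definition lcs :: "('a, 'b) monoid_scheme \<Rightarrow> nat \<Rightarrow> 'a set" where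
  "lcs G n = iter_comm G (carrier G) n"

definition nilpotent_group :: "('a, 'b) monoid_scheme \<Rightarrow> bool" where
  "nilpotent_group G \<longleftrightarrow> group G \<and> (\<exists>c. lcs G c = {\<one>\<^bsub>G\<^esub>})"

text \<open>A letter (x, True) stands for x, (x, False) for x^-1.\<close>
definition inv_letter :: "'x \<times> bool \<Rightarrow> 'x \<times> bool" where
  "inv_letter l = (fst l, \<not> snd l)"

fun reduced :: "('x \<times> bool) list \<Rightarrow> bool" where
  "reduced [] = True"
| "reduced [l] = True"
| "reduced (l # m # w) = (m \<noteq> inv_letter l \<and> reduced (m # w))"

definition reduce_cons :: "'x \<times> bool \<Rightarrow> ('x \<times> bool) list \<Rightarrow> ('x \<times> bool) list" where
  "reduce_cons l w = (case w of [] \<Rightarrow> [l] | m # w' \<Rightarrow> (if m = inv_letter l then w' else l # w))"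

definition reduce :: "('x \<times> bool) list \<Rightarrow> ('x \<times> bool) list" where
  "reduce w = foldr reduce_cons w []"

definition free_group :: "'x set \<Rightarrow> ('x \<times> bool) list monoid" where
  "free_group S = \<lparr> carrier = {w. reduced w \<and> fst ` set w \<subseteq> S},
                    monoid.mult = (\<lambda>u v. reduce (u @ v)),
                    one = [] \<rparr>"

text \<open>Evaluation of words in K: the homomorphism F(carrier K) -> K extending the identity.\<close>
definition eval_word :: "('a, 'b) monoid_scheme \<Rightarrow> ('a \<times> bool) list \<Rightarrow> 'a" where
  "eval_word K w = foldr (\<lambda>l acc. (if snd l then fst l else inv\<^bsub>K\<^esub> (fst l)) \<otimes>\<^bsub>K\<^esub> acc) w \<one>\<^bsub>K\<^esub>"

definition pres_F :: "('a, 'b) monoid_scheme \<Rightarrow> ('a \<times> bool) list monoid" where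
  "pres_F K = free_group (carrier K)"

definition pres_R :: "('a, 'b) monoid_scheme \<Rightarrow> ('a \<times> bool) list set" where
  "pres_R K = kernel (pres_F K) K (eval_word K)"

text \<open>Baer invariant N_c M(K) = (R \<inter> gamma_(c+1)(F)) / [R, c F], computed from the
  canonical free presentation 1 -> R -> F(carrier K) -> K -> 1.\<close>
definition baer_invariant :: "nat \<Rightarrow> ('a, 'b) monoid_scheme \<Rightarrow> ('a \<times> bool) list set monoid" where
  "baer_invariant c K =
     (pres_F K)\<lparr>carrier := pres_R K \<inter> lcs (pres_F K) c\<rparr> Mod iter_comm (pres_F K) (pres_R K) c"

text \<open>A_p: the subgroup of elements of p-power order (for a finite abelian group A).\<close>
definition sylow_part :: "nat \<Rightarrow> ('a, 'b) monoid_scheme \<Rightarrow> ('a, 'b) monoid_scheme" where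
  "sylow_part p A = A\<lparr>carrier := {x \<in> carrier A. \<exists>k. group.ord A x = p ^ k}\<rparr>"

end

theory Submission
  imports Defs
begin

text \<open>
  Write \<open>S = [R, \<^sub>c F]\<close>, and let \<open>Z\<^sub>i(T)\<close> be the preimage in \<open>F\<close> of the \<open>i\<close>-th centre of \<open>F/T\<close>, so that
  \<open>R \<subseteq> Z\<^sub>c(S)\<close> and \<open>F/S\<close> is nilpotent when \<open>G\<close> is. Suppose that an endomorphism \<open>\<phi>\<close> of \<open>F\<close> moves each
  element only by torsion modulo \<open>Z\<^sub>c(S)\<close>, with orders in a multiplicative set \<open>M\<close>. Let \<open>T/S\<close> be a maximal
  normal \<open>M\<close>-torsion subgroup of \<open>F/S\<close>. The centre of \<open>F/T\<close> has no \<open>M\<close>-torsion, hence neither has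
  \<open>F/Z\<^sub>c(T)\<close>, so \<open>\<phi>\<close> is the identity modulo \<open>Z\<^sub>c(T)\<close>. An endomorphism that is trivial modulo \<open>Z\<^sub>c(T)\<close> is
  trivial on \<open>\<gamma>\<^bsub>c+1\<^esub>(F)\<close> modulo \<open>T\<close>; thus \<open>\<phi>\<close> moves \<open>\<gamma>\<^bsub>c+1\<^esub>(F)\<close> only by \<open>M\<close>-torsion modulo \<open>S\<close>.

  The retraction of \<open>G\<close> onto its Sylow subgroup \<open>P\<close> induces a retraction of \<open>F(G)\<close> onto \<open>F(P)\<close>.
  With \<open>M\<close> the integers prime to \<open>p\<close>, it fixes all \<open>p\<close>-torsion of the Baer invariant of \<open>G\<close>. The trivial
  endomorphism of \<open>F(P)\<close>, with \<open>M\<close> the powers of \<open>p\<close>, shows that the Baer invariant of \<open>P\<close> is a \<open>p\<close>-group.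
  Hence the map induced by \<open>F(P) \<subseteq> F(G)\<close> is an isomorphism onto the \<open>p\<close>-part.
\<close>

section \<open>Commutators and the relative upper central series\<close>

definition gcomm :: "('a, 'b) monoid_scheme \<Rightarrow> 'a \<Rightarrow> 'a \<Rightarrow> 'a" where
  "gcomm G a b = a \<otimes>\<^bsub>G\<^esub> b \<otimes>\<^bsub>G\<^esub> inv\<^bsub>G\<^esub> a \<otimes>\<^bsub>G\<^esub> inv\<^bsub>G\<^esub> b"

text \<open>\<open>ucs G T n\<close> is the preimage in \<open>G\<close> of the \<open>n\<close>-th centre of \<open>G/T\<close>.\<close>
primrec ucs :: "('a, 'b) monoid_scheme \<Rightarrow> 'a set \<Rightarrow> nat \<Rightarrow> 'a set" where
  "ucs G T 0 = T"
| "ucs G T (Suc n) = {x \<in> carrier G. \<forall>g\<in>carrier G. gcomm G x g \<in> ucs G T n}"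

context group
begin

text \<open>Free cancellation in right-nested products; together with associativity it reduces the
  commutator identities below to comparisons of words.\<close>

lemma inv_mult_cancel [simp]:
  assumes "x \<in> carrier G" "y \<in> carrier G"
  shows "inv x \<otimes> (x \<otimes> y) = y" and "x \<otimes> (inv x \<otimes> y) = y"
  using assms by (simp_all flip: m_assoc)

lemma gcomm_closed [simp]:
  "a \<in> carrier G \<Longrightarrow> b \<in> carrier G \<Longrightarrow> gcomm G a b \<in> carrier G"
  by (simp add: gcomm_def)

lemma gcomm_mult_left:
  assumes "a \<in> carrier G" "b \<in> carrier G" "g \<in> carrier G"
  shows "gcomm G (a \<otimes> b) g = a \<otimes> gcomm G b g \<otimes> inv a \<otimes> gcomm G a g"
  using assms by (simp add: gcomm_def m_assoc inv_mult_group)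

lemma gcomm_mult_right:
  assumes "a \<in> carrier G" "g \<in> carrier G" "w \<in> carrier G"
  shows "gcomm G a (g \<otimes> w) = gcomm G a g \<otimes> (g \<otimes> gcomm G a w \<otimes> inv g)"
  using assms by (simp add: gcomm_def m_assoc inv_mult_group)

lemma gcomm_inv_left:
  assumes "a \<in> carrier G" "g \<in> carrier G"
  shows "gcomm G (inv a) g = inv a \<otimes> inv (gcomm G a g) \<otimes> a"
  using assms by (simp add: gcomm_def m_assoc inv_mult_group)

lemma gcomm_conj:
  assumes "a \<in> carrier G" "g \<in> carrier G" "h \<in> carrier G"
  shows "gcomm G (h \<otimes> a \<otimes> inv h) g = h \<otimes> gcomm G a (inv h \<otimes> g \<otimes> h) \<otimes> inv h"
  using assms by (simp add: gcomm_def m_assoc inv_mult_group)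

lemma normal_conj:
  assumes "N \<lhd> G" "x \<in> N" "h \<in> carrier G"
  shows "h \<otimes> x \<otimes> inv h \<in> N" and "inv h \<otimes> x \<otimes> h \<in> N"
  using assms by (auto simp: normal.inv_op_closed1 normal.inv_op_closed2)

lemma gcomm_mem_normal:
  assumes N: "N \<lhd> G" and "x \<in> N" "g \<in> carrier G"
  shows "gcomm G x g \<in> N"
proof -
  interpret normal N G by (fact N)
  have "gcomm G x g = x \<otimes> (g \<otimes> inv x \<otimes> inv g)"
    using assms by (simp add: gcomm_def m_assoc)
  then show ?thesis using assms by (simp add: normal_conj(1)[OF N])
qed

text \<open>Products and inverses are handled by expanding the commutator in its first argument.
  Conjugating that argument amounts to conjugating the value and changing the second argument, which
  ranges over the whole group anyway.\<close>

lemma normal_ucs: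
  assumes T: "T \<lhd> G"
  shows "ucs G T n \<lhd> G"
proof (induction n)
  case 0
  show ?case using T by simp
next
  case (Suc n)
  interpret Z: normal "ucs G T n" G by (fact Suc)
  show ?case
    unfolding normal_inv_iff
  proof (intro conjI ballI subgroupI)
    show "ucs G T (Suc n) \<subseteq> carrier G" by auto
    have "\<one> \<in> ucs G T (Suc n)" by (simp add: gcomm_def)
    then show "ucs G T (Suc n) \<noteq> {}" by blast
    fix x h assume "x \<in> carrier G" "h \<in> ucs G T (Suc n)"
    then show "x \<otimes> h \<otimes> inv x \<in> ucs G T (Suc n)"
      by (simp add: gcomm_conj normal_conj[OF Suc])
  qed (auto simp: gcomm_mult_left gcomm_inv_left normal_conj[OF Suc])
qed

lemma ucs_carrier: "T \<lhd> G \<Longrightarrow> ucs G T n \<subseteq> carrier G"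
  using normal_ucs normal_imp_subgroup subgroup.subset by blast

lemma ucs_Suc_mono:
  assumes "T \<lhd> G" shows "ucs G T n \<subseteq> ucs G T (Suc n)"
  using gcomm_mem_normal[OF normal_ucs[OF assms, of n]] ucs_carrier[OF assms, of n] by auto

lemma ucs_mono_index:
  assumes "T \<lhd> G" "m \<le> n" shows "ucs G T m \<subseteq> ucs G T n"
  using lift_Suc_mono_le[of "ucs G T"] ucs_Suc_mono assms by blast

lemma ucs_mono: "S \<subseteq> T \<Longrightarrow> ucs G S n \<subseteq> ucs G T n"
  by (induction n) auto

text \<open>The recursion adds layers at the top; this identity lets an induction replace the base
  \<open>T\<close> instead.\<close>

lemma ucs_ucs: "ucs G (ucs G T m) n = ucs G T (m + n)"
  by (induction n) auto

text \<open>The two commutators differ by a product of conjugates of two error terms, one for each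
  perturbed argument. Since only these error terms must lie in \<open>N\<close>, the perturbations
  \<open>v\<close> and \<open>w\<close> may lie higher in the central series.\<close>

lemma gcomm_congruent:
  assumes N: "N \<lhd> G" and [simp]: "a \<in> carrier G" "g \<in> carrier G" "v \<in> carrier G" "w \<in> carrier G"
    and "gcomm G v (g \<otimes> w) \<in> N" "gcomm G a w \<in> N"
  shows "inv (gcomm G a g) \<otimes> gcomm G (a \<otimes> v) (g \<otimes> w) \<in> N"
proof -
  interpret normal N G by (fact N)
  have "inv (gcomm G a g) \<otimes> gcomm G (a \<otimes> v) (g \<otimes> w) =
    (inv (gcomm G a g) \<otimes> (a \<otimes> gcomm G v (g \<otimes> w) \<otimes> inv a) \<otimes> gcomm G a g) \<otimes> (g \<otimes> gcomm G a w \<otimes> inv g)"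
    using gcomm_mult_left[of a v "g \<otimes> w"] gcomm_mult_right[of a g w] by (simp add: m_assoc)
  also have "\<dots> \<in> N"
    using assms by (intro m_closed normal_conj[OF N]) auto
  finally show ?thesis .
qed

text \<open>Congruence modulo \<open>N\<close> is written \<open>inv x \<otimes> x' \<in> N\<close>.
  With its companion for inverses, this carries a congruence from generators to the subgroup they
  generate.\<close>

lemma normal_congruent_mult:
  assumes N: "N \<lhd> G" and [simp]: "x \<in> carrier G" "y \<in> carrier G" "x' \<in> carrier G" "y' \<in> carrier G"
    and "inv x \<otimes> x' \<in> N" "inv y \<otimes> y' \<in> N"
  shows "inv (x \<otimes> y) \<otimes> (x' \<otimes> y') \<in> N"
proof -
  interpret normal N G by (fact N)
  have "inv (x \<otimes> y) \<otimes> (x' \<otimes> y') = (inv y \<otimes> (inv x \<otimes> x') \<otimes> y) \<otimes> (inv y \<otimes> y')"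
    by (simp add: m_assoc inv_mult_group)
  also have "\<dots> \<in> N"
    by (rule m_closed[OF normal_conj(2)[OF N]]) (use assms in auto)
  finally show ?thesis .
qed

lemma normal_congruent_inv:
  assumes N: "N \<lhd> G" and [simp]: "x \<in> carrier G" "x' \<in> carrier G" and "inv x \<otimes> x' \<in> N"
  shows "inv (inv x) \<otimes> inv x' \<in> N"
proof -
  interpret normal N G by (fact N)
  have "inv (inv x) \<otimes> inv x' = x \<otimes> inv (inv x \<otimes> x') \<otimes> inv x"
    by (simp add: m_assoc inv_mult_group)
  also have "\<dots> \<in> N"
    using assms by (intro normal_conj[OF N]) auto
  finally show ?thesis .
qed

section \<open>Commutator subgroups, iterated commutators and central series\<close>

lemma comm_subgroup_gcomm:
  "comm_subgroup G A B = generate G {gcomm G a b | a b. a \<in> A \<and> b \<in> B}"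
  unfolding comm_subgroup_def gcomm_def by (rule arg_cong[where f = "generate G"]) auto

text \<open>A conjugate of a commutator is the commutator of the conjugates, so the generating set
  is stable under conjugation.\<close>

lemma normal_comm_subgroup:
  assumes N: "N \<lhd> G"
  shows "comm_subgroup G N (carrier G) \<lhd> G" and "comm_subgroup G N (carrier G) \<subseteq> N"
proof -
  interpret N: normal N G by (fact N)
  let ?C = "{gcomm G a b | a b. a \<in> N \<and> b \<in> carrier G}"
  have C: "?C \<subseteq> N" using gcomm_mem_normal[OF N] by auto
  then show "comm_subgroup G N (carrier G) \<subseteq> N"
    unfolding comm_subgroup_gcomm by (rule generate_subgroup_incl) (rule N.subgroup_axioms)
  show "comm_subgroup G N (carrier G) \<lhd> G"
    unfolding comm_subgroup_gcomm
  proof (rule normal_generateI)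
    show "?C \<subseteq> carrier G" using C N.subset by blast
    fix h g assume "h \<in> ?C" and g: "g \<in> carrier G"
    then obtain a b where ab: "h = gcomm G a b" "a \<in> N" "b \<in> carrier G" by blast
    have "g \<otimes> h \<otimes> inv g = gcomm G (g \<otimes> a \<otimes> inv g) (g \<otimes> b \<otimes> inv g)"
      using ab g N.subset by (auto simp: gcomm_def m_assoc inv_mult_group)
    then show "g \<otimes> h \<otimes> inv g \<in> ?C"
      using ab g normal_conj[OF N] by blast
  qed
qed

lemma normal_iter_comm: "N \<lhd> G \<Longrightarrow> iter_comm G N n \<lhd> G"
  by (induction n) (auto intro: normal_comm_subgroup)

lemma iter_comm_subset: "N \<lhd> G \<Longrightarrow> iter_comm G N n \<subseteq> N"
  using normal_comm_subgroup(2)[OF normal_iter_comm] by (induction n) auto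

lemma normal_carrier: "carrier G \<lhd> G"
  by (simp add: normal_inv_iff subgroup_self)

lemma normal_lcs: "lcs G n \<lhd> G"
  unfolding lcs_def by (rule normal_iter_comm[OF normal_carrier])

text \<open>The outermost commutator is peeled off: \<open>iter_comm G N n\<close> is central modulo
  \<open>T\<close>, so the induction continues with \<open>T\<close> replaced by
  \<open>ucs G T (Suc 0)\<close>.\<close>

lemma subset_ucs_iter_comm:
  assumes "N \<lhd> G" "iter_comm G N n \<subseteq> T"
  shows "N \<subseteq> ucs G T n"
  using assms(2)
proof (induction n arbitrary: T)
  case (Suc n)
  have "iter_comm G N n \<subseteq> ucs G T (Suc 0)"
  proof
    fix x assume x: "x \<in> iter_comm G N n"
    then have "gcomm G x g \<in> T" if "g \<in> carrier G" for g
      using that Suc.prems by (auto simp: comm_subgroup_gcomm intro!: generate.incl)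
    moreover have "x \<in> carrier G"
      using x normal_iter_comm[OF assms(1)] normal_imp_subgroup subgroup.subset by blast
    ultimately show "x \<in> ucs G T (Suc 0)" by simp
  qed
  then have "N \<subseteq> ucs G (ucs G T (Suc 0)) n" by (rule Suc.IH)
  then show ?case unfolding ucs_ucs by simp
qed simp

text \<open>Naturality, used later for evaluation of words, for inclusions and for the retraction of
  free groups. Inclusion is all that can be expected, as \<open>h\<close> may fail to be
  onto.\<close>

lemma iter_comm_hom_image:
  assumes h: "group_hom G H h" and N: "N \<lhd> G" and sub: "h ` N \<subseteq> M"
  shows "h ` iter_comm G N n \<subseteq> iter_comm H M n"
proof (induction n)
  case (Suc n)
  interpret h: group_hom G H h by (fact h)
  have c: "iter_comm G N n \<subseteq> carrier G"
    using normal_iter_comm[OF N] normal_imp_subgroup subgroup.subset by blast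
  let ?C = "{gcomm G a b | a b. a \<in> iter_comm G N n \<and> b \<in> carrier G}"
  let ?D = "{gcomm H a b | a b. a \<in> iter_comm H M n \<and> b \<in> carrier H}"
  have Cc: "?C \<subseteq> carrier G" using c by auto
  have D: "h x \<in> ?D" if "x \<in> ?C" for x
  proof -
    obtain a b where ab: "x = gcomm G a b" "a \<in> iter_comm G N n" "b \<in> carrier G"
      using \<open>x \<in> ?C\<close> by blast
    then have "h x = gcomm H (h a) (h b)" using c by (auto simp: gcomm_def)
    moreover have "h a \<in> iter_comm H M n" "h b \<in> carrier H" using ab Suc by auto
    ultimately show ?thesis by auto
  qed
  have "h x \<in> comm_subgroup H (iter_comm H M n) (carrier H)" if "x \<in> generate G ?C" for x
    using that
  proof (induction rule: generate.induct)
    case (inv x)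
    then have "x \<in> carrier G" using Cc by blast
    then have "h (inv x) = inv\<^bsub>H\<^esub> (h x)" by simp
    then show ?case
      using generate.inv[OF D[OF inv]] by (simp add: h.H.comm_subgroup_gcomm)
  next
    case (incl x)
    then show ?case
      using generate.incl[OF D[OF incl]] by (simp add: h.H.comm_subgroup_gcomm)
  next
    case (eng x y)
    then have "x \<in> carrier G" "y \<in> carrier G"
      using Cc generate_incl by blast+
    then show ?case using eng.IH by (simp add: h.H.comm_subgroup_gcomm generate.eng)
  qed (simp add: h.H.comm_subgroup_gcomm generate.one)
  then show ?case unfolding iter_comm.simps comm_subgroup_gcomm by blast
qed (use sub in simp)

text \<open>In the induction step, commutators of lower with upper central elements are controlled by the
  induction hypothesis for the inner automorphism of the upper central element.\<close>
lemma lcs_congruent_endomorphism: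
  assumes T: "T \<lhd> G" and "\<phi> \<in> hom G G"
    and "\<And>x. x \<in> carrier G \<Longrightarrow> inv x \<otimes> \<phi> x \<in> ucs G T (i + j)" and "x \<in> lcs G j"
  shows "inv x \<otimes> \<phi> x \<in> ucs G T i"
  using assms(2-)
proof (induction j arbitrary: i \<phi> x)
  case 0
  then show ?case by (simp add: lcs_def)
next
  case (Suc j)
  interpret \<phi>: group_hom G G \<phi>
    using Suc.prems(1) by (simp add: group_hom_def group_hom_axioms_def)
  note Zi = normal_ucs[OF T, of i]
  have lcsc: "lcs G j \<subseteq> carrier G"
    using normal_lcs normal_imp_subgroup subgroup.subset by blast
  let ?C = "{gcomm G a b | a b. a \<in> lcs G j \<and> b \<in> carrier G}"
  have Cc: "?C \<subseteq> carrier G" using lcsc by auto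
  have C: "inv x \<otimes> \<phi> x \<in> ucs G T i" if "x \<in> ?C" for x
  proof -
    obtain a g where x: "x = gcomm G a g" "a \<in> lcs G j" and g: "g \<in> carrier G"
      using \<open>x \<in> ?C\<close> by blast
    have a: "a \<in> carrier G" using x lcsc by blast
    define v where "v = inv a \<otimes> \<phi> a"
    define w where "w = inv g \<otimes> \<phi> g"
    have vw: "v \<in> carrier G" "w \<in> carrier G" using a g by (simp_all add: v_def w_def)
    \<comment> \<open>The induction hypothesis is used one layer higher, because
      \<open>i + Suc j\<close> equals \<open>Suc i + j\<close>.\<close>
    have "v \<in> ucs G T (Suc i)"
      unfolding v_def using Suc.prems(2) by (intro Suc.IH[OF Suc.prems(1) _ x(2)]) simp
    then have v': "gcomm G v (g \<otimes> w) \<in> ucs G T i" using g vw by simp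
    have w: "w \<in> ucs G T (Suc (i + j))"
      unfolding w_def using Suc.prems(2)[OF g] by simp
    have "inv a \<otimes> (w \<otimes> a \<otimes> inv w) \<in> ucs G T i"
    proof (rule Suc.IH[OF _ _ x(2), of "\<lambda>y. w \<otimes> y \<otimes> inv w"])
      show "(\<lambda>y. w \<otimes> y \<otimes> inv w) \<in> hom G G"
        using vw by (auto simp: hom_def m_assoc)
      fix y assume y: "y \<in> carrier G"
      have "gcomm G w (inv y) \<in> ucs G T (i + j)" using w y by simp
      \<comment> \<open>Conjugation by \<open>w\<close> displaces \<open>y\<close> by a conjugate of
        their commutator, which lies one layer below \<open>w\<close>.\<close>
      then have "inv y \<otimes> gcomm G w y \<otimes> y \<in> ucs G T (i + j)"
        using w y by (intro normal_conj[OF normal_ucs[OF T]]) auto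
      then show "inv y \<otimes> (w \<otimes> y \<otimes> inv w) \<in> ucs G T (i + j)"
        using y vw by (simp add: gcomm_def m_assoc)
    qed
    \<comment> \<open>The element just found is the commutator of \<open>inv a\<close> with
      \<open>w\<close>; conjugating it by \<open>a\<close> and inverting gives the commutator of
      \<open>a\<close> with \<open>w\<close>.\<close>
    then have "inv (a \<otimes> (inv a \<otimes> (w \<otimes> a \<otimes> inv w)) \<otimes> inv a) \<in> ucs G T i"
      using a normal_conj[OF Zi] by (meson Zi normal_imp_subgroup subgroup.m_inv_closed)
    then have "gcomm G a w \<in> ucs G T i"
      using a vw by (simp add: gcomm_def m_assoc inv_mult_group)
    then have "inv (gcomm G a g) \<otimes> gcomm G (a \<otimes> v) (g \<otimes> w) \<in> ucs G T i"
      using a g vw v' by (intro gcomm_congruent[OF Zi])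
    moreover have "\<phi> x = gcomm G (a \<otimes> v) (g \<otimes> w)"
      using a g unfolding x(1) v_def w_def by (simp add: gcomm_def)
    ultimately show ?thesis by (simp add: x(1))
  qed
  have "x \<in> generate G ?C"
    using Suc.prems(3) by (simp add: lcs_def comm_subgroup_gcomm)
  then show ?case
  proof (induction rule: generate.induct)
    case one
    show ?case using subgroup.one_closed[OF normal_imp_subgroup[OF Zi]] by simp
  next
    case (incl x)
    then show ?case by (rule C)
  next
    case (inv x)
    then have "x \<in> carrier G" using Cc by blast
    then show ?case using normal_congruent_inv[OF Zi _ _ C[OF inv]] by simp
  next
    case (eng x y)
    then have "x \<in> carrier G" "y \<in> carrier G"
      using Cc generate_incl by blast+
    then show ?case using normal_congruent_mult[OF Zi _ _ _ _ eng.IH] by simp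
  qed
qed

end

section \<open>Torsion modulo a normal subgroup\<close>

context group
begin

lemma normal_quotient_hom:
  assumes "N \<lhd> G"
  shows "group_hom G (G Mod N) (\<lambda>x. N #> x)"
  using assms normal.r_coset_hom_Mod normal.factorgroup_is_group
  by (auto simp: group_hom_def group_hom_axioms_def)

lemma normal_quotient_eq_one:
  assumes "N \<lhd> G" "x \<in> carrier G"
  shows "N #> x = \<one>\<^bsub>G Mod N\<^esub> \<longleftrightarrow> x \<in> N"
  using assms coset_join1 coset_join2 normal_imp_subgroup subgroup.subset
  by (metis (no_types) one_FactGroup)

lemma pow_mult_congruent:
  fixes n :: nat
  assumes N: "N \<lhd> G" and [simp]: "x \<in> carrier G" "y \<in> carrier G" and c: "gcomm G x y \<in> N"
  shows "N #> (x \<otimes> y) [^] n = N #> (x [^] n \<otimes> y [^] n)"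
proof -
  interpret q: group_hom G "G Mod N" "\<lambda>x. N #> x" by (rule normal_quotient_hom[OF N])
  have "x \<otimes> y = gcomm G x y \<otimes> (y \<otimes> x)" by (simp add: gcomm_def m_assoc)
  moreover have "N #> gcomm G x y = \<one>\<^bsub>G Mod N\<^esub>"
    using c by (simp add: normal_quotient_eq_one[OF N] del: one_FactGroup)
  ultimately have "N #> (x \<otimes> y) = N #> (y \<otimes> x)"
    by (metis q.hom_mult q.H.l_one gcomm_closed assms(2,3) m_closed q.hom_closed)
  then have "(N #> x) \<otimes>\<^bsub>G Mod N\<^esub> (N #> y) = (N #> y) \<otimes>\<^bsub>G Mod N\<^esub> (N #> x)"
    by (simp del: mult_FactGroup flip: q.hom_mult)
  then have "((N #> x) \<otimes>\<^bsub>G Mod N\<^esub> (N #> y)) [^]\<^bsub>G Mod N\<^esub> n =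
      (N #> x) [^]\<^bsub>G Mod N\<^esub> n \<otimes>\<^bsub>G Mod N\<^esub> (N #> y) [^]\<^bsub>G Mod N\<^esub> n"
    by (intro q.H.pow_mult_distrib) simp_all
  then show ?thesis
    by (simp add: q.hom_nat_pow del: mult_FactGroup)
qed

lemma pow_mult_mem_normal:
  fixes n :: nat
  assumes N: "N \<lhd> G" and "x \<in> carrier G" "y \<in> carrier G" "gcomm G x y \<in> N"
    and "x [^] n \<in> N" "y [^] n \<in> N"
  shows "(x \<otimes> y) [^] n \<in> N"
proof -
  have "x [^] n \<otimes> y [^] n \<in> N"
    using assms subgroup.m_closed[OF normal_imp_subgroup[OF N]] by blast
  then show ?thesis
    using normal_quotient_eq_one[OF N] pow_mult_congruent[OF assms(1-4)] assms(2,3)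
    by (metis m_closed nat_pow_closed)
qed

lemma subgroup_nat_pow_mem: "subgroup H G \<Longrightarrow> x \<in> H \<Longrightarrow> x [^] (n::nat) \<in> H"
  by (induction n) (auto simp: subgroup.one_closed subgroup.m_closed)

lemma mem_normal_pow_dvd:
  fixes m n :: nat
  assumes N: "N \<lhd> G" and "x \<in> carrier G" "x [^] m \<in> N" "m dvd n"
  shows "x [^] n \<in> N"
proof -
  interpret N: normal N G by (fact N)
  obtain k where "n = m * k" using assms(4) by blast
  then show ?thesis
    using assms N.subgroup_axioms by (simp add: nat_pow_pow[symmetric] subgroup_nat_pow_mem)
qed

text \<open>The order of the coset of \<open>x\<close> divides two coprime numbers.\<close>

lemma mem_normal_coprime_pow:
  fixes m n :: nat
  assumes N: "N \<lhd> G" and x: "x \<in> carrier G" "x [^] m \<in> N" "x [^] n \<in> N" and "coprime m n"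
  shows "x \<in> N"
proof -
  interpret q: group_hom G "G Mod N" "\<lambda>x. N #> x" by (rule normal_quotient_hom[OF N])
  have "q.H.ord (N #> x) dvd k" if "x [^] k \<in> N" for k :: nat
    using that x(1) by (simp add: q.H.pow_eq_id[symmetric] normal_quotient_eq_one[OF N]
      flip: q.hom_nat_pow del: one_FactGroup)
  then have "q.H.ord (N #> x) = 1"
    using x(2,3) \<open>coprime m n\<close> coprime_common_divisor_nat by blast
  then show ?thesis
    using q.H.ord_eq_1 x(1) normal_quotient_eq_one[OF N] by (metis q.hom_closed)
qed

lemma conj_nat_pow:
  assumes "x \<in> carrier G" "h \<in> carrier G"
  shows "(h \<otimes> x \<otimes> inv h) [^] (n::nat) = h \<otimes> x [^] n \<otimes> inv h"
  using assms by (induction n) (simp_all add: m_assoc)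

text \<open>Zorn's lemma yields a maximal \<open>T\<close>. The \<open>M\<close>-torsion of the
  centre of \<open>G/T\<close> pulls back to a normal subgroup that is again
  \<open>M\<close>-torsion modulo \<open>S\<close>, as exponents multiply; by maximality it equals
  \<open>T\<close>.\<close>

lemma ex_torsion_radical:
  fixes M :: "nat set"
  assumes S: "S \<lhd> G" and M1: "1 \<in> M" and Mm: "\<forall>m\<in>M. \<forall>n\<in>M. m * n \<in> M"
  shows "\<exists>T. T \<lhd> G \<and> S \<subseteq> T \<and> (\<forall>t\<in>T. \<exists>m\<in>M. t [^] m \<in> S) \<and>
    (\<forall>z\<in>ucs G T (Suc 0). \<forall>m\<in>M. z [^] m \<in> T \<longrightarrow> z \<in> T)"
proof -
  define \<Gamma> where "\<Gamma> = {T. T \<lhd> G \<and> S \<subseteq> T \<and> (\<forall>t\<in>T. \<exists>m\<in>M. t [^] m \<in> S)}"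
  interpret S: normal S G by (fact S)
  have "\<exists>T\<in>\<Gamma>. \<forall>Y\<in>\<Gamma>. T \<subseteq> Y \<longrightarrow> Y = T"
  proof (rule subset_Zorn_nonempty)
    have "S \<in> \<Gamma>"
      using S M1 S.subset by (auto simp: \<Gamma>_def intro!: bexI[of _ 1])
    then show "\<Gamma> \<noteq> {}" by blast
    fix C assume C: "C \<noteq> {}" and ch: "subset.chain \<Gamma> C"
    then have CT: "C \<subseteq> \<Gamma>" and lin: "\<And>U V. U \<in> C \<Longrightarrow> V \<in> C \<Longrightarrow> U \<subseteq> V \<or> V \<subseteq> U"
      by (auto simp: subset_chain_def)
    have sg: "subgroup U G" if "U \<in> C" for U
      using that CT by (auto simp: \<Gamma>_def normal_imp_subgroup)
    have "\<Union>C \<lhd> G"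
      unfolding normal_inv_iff
    proof (intro conjI ballI subgroupI)
      show "\<Union>C \<subseteq> carrier G" using sg by (meson Union_least subgroup.subset)
      show "\<Union>C \<noteq> {}" using C sg subgroup.one_closed by blast
      show "inv a \<in> \<Union>C" if "a \<in> \<Union>C" for a
        using that sg by (meson UnionE UnionI subgroup.m_inv_closed)
      show "a \<otimes> b \<in> \<Union>C" if ab: "a \<in> \<Union>C" "b \<in> \<Union>C" for a b
      proof -
        obtain U V where UV: "U \<in> C" "V \<in> C" "a \<in> U" "b \<in> V" using ab by blast
        then obtain Z where "Z \<in> C" "a \<in> Z" "b \<in> Z" using lin[of U V] by blast
        then show ?thesis using sg by (meson UnionI subgroup.m_closed)
      qed
      show "x \<otimes> h \<otimes> inv x \<in> \<Union>C" if "x \<in> carrier G" "h \<in> \<Union>C" for x h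
      proof -
        obtain U where "U \<in> C" "h \<in> U" using \<open>h \<in> \<Union>C\<close> by blast
        moreover from this have "U \<lhd> G" using CT by (auto simp: \<Gamma>_def)
        ultimately show ?thesis using normal_conj(1)[of U h x] \<open>x \<in> carrier G\<close> by blast
      qed
    qed
    then show "\<Union>C \<in> \<Gamma>" using C CT by (auto simp: \<Gamma>_def)
  qed
  then obtain T where T: "T \<in> \<Gamma>" and max: "\<And>Y. Y \<in> \<Gamma> \<Longrightarrow> T \<subseteq> Y \<Longrightarrow> Y = T" by blast
  have TN: "T \<lhd> G" and ST: "S \<subseteq> T" and tor: "\<And>t. t \<in> T \<Longrightarrow> \<exists>m\<in>M. t [^] m \<in> S"
    using T by (auto simp: \<Gamma>_def)
  interpret T: normal T G by (fact TN)
  note Zs = normal_imp_subgroup[OF normal_ucs[OF TN, of "Suc 0"]]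
  \<comment> \<open>Restricting to elements central modulo \<open>T\<close> makes them commute
    there, so the product of two exponents kills a product.\<close>
  define T' where "T' = {z \<in> ucs G T (Suc 0). \<exists>m\<in>M. z [^] m \<in> T}"
  have "T \<subseteq> ucs G T (Suc 0)" using ucs_Suc_mono[OF TN, of 0] by simp
  then have TT': "T \<subseteq> T'" using M1 T.subset by (auto simp: T'_def intro!: bexI[of _ 1])
  have "T' \<lhd> G"
    unfolding normal_inv_iff
  proof (intro conjI ballI subgroupI)
    show "T' \<subseteq> carrier G" by (auto simp: T'_def)
    show "T' \<noteq> {}" using TT' T.one_closed by blast
    show "inv a \<in> T'" if "a \<in> T'" for a
    proof -
      obtain m where m: "m \<in> M" "a [^] m \<in> T" and a: "a \<in> ucs G T (Suc 0)" using \<open>a \<in> T'\<close> by (auto simp: T'_def)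
      then have "inv a [^] m \<in> T" by (simp add: nat_pow_inv)
      then show ?thesis using m(1) subgroup.m_inv_closed[OF Zs a] unfolding T'_def by blast
    qed
    show "a \<otimes> b \<in> T'" if ab: "a \<in> T'" "b \<in> T'" for a b
    proof -
      obtain m n where mn: "m \<in> M" "n \<in> M" "a [^] m \<in> T" "b [^] n \<in> T"
        using ab by (auto simp: T'_def)
      have Z: "a \<in> ucs G T (Suc 0)" "b \<in> ucs G T (Suc 0)" using ab by (auto simp: T'_def)
      then have [simp]: "a \<in> carrier G" "b \<in> carrier G" by auto
      have "(a \<otimes> b) [^] (m * n) \<in> T"
      proof (rule pow_mult_mem_normal[OF TN])
        show "gcomm G a b \<in> T" using Z by simp
        show "a [^] (m * n) \<in> T" using mem_normal_pow_dvd[OF TN _ mn(3)] by simp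
        show "b [^] (m * n) \<in> T" using mem_normal_pow_dvd[OF TN _ mn(4)] by simp
      qed simp_all
      moreover have "a \<otimes> b \<in> ucs G T (Suc 0)" using Z by (rule subgroup.m_closed[OF Zs])
      ultimately show ?thesis using Mm mn(1,2) unfolding T'_def by blast
    qed
    show "h \<otimes> z \<otimes> inv h \<in> T'" if h: "h \<in> carrier G" and "z \<in> T'" for h z
    proof -
      obtain m where m: "m \<in> M" "z [^] m \<in> T" and z: "z \<in> ucs G T (Suc 0)"
        using \<open>z \<in> T'\<close> by (auto simp: T'_def)
      have "z \<in> carrier G" using z by simp
      then have "(h \<otimes> z \<otimes> inv h) [^] m \<in> T"
        using normal_conj(1)[OF TN m(2) h] using h by (simp add: conj_nat_pow)
      then show ?thesis using m(1) normal_conj(1)[OF normal_ucs[OF TN] z h] unfolding T'_def by blast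
    qed
  qed
  moreover have "\<exists>k\<in>M. t [^] k \<in> S" if "t \<in> T'" for t
  proof -
    obtain m where m: "m \<in> M" "t [^] m \<in> T" "t \<in> carrier G" using \<open>t \<in> T'\<close> by (auto simp: T'_def)
    obtain k where "k \<in> M" "(t [^] m) [^] k \<in> S" using tor[OF m(2)] by blast
    then show ?thesis using m Mm by (auto simp: nat_pow_pow)
  qed
  ultimately have "T' \<in> \<Gamma>" using TT' ST by (auto simp: \<Gamma>_def)
  then have "T' = T" using max TT' by blast
  then have "\<forall>z\<in>ucs G T (Suc 0). \<forall>m\<in>M. z [^] m \<in> T \<longrightarrow> z \<in> T"
    unfolding T'_def by blast
  then show ?thesis using TN ST tor by blast
qed

text \<open>If the commutator of \<open>z\<close> and \<open>g\<close> is central modulo a layer,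
  its \<open>m\<close>-th power is congruent there to the commutator of \<open>z [^] m\<close> and
  \<open>g\<close>. Torsion of \<open>z\<close> thus passes to its commutators one layer down, and
  finally to the centre of \<open>G/T\<close>.\<close>

lemma ucs_isolated_Suc:
  fixes m :: nat
  assumes T: "T \<lhd> G" and iso: "\<And>z. z \<in> ucs G T (Suc 0) \<Longrightarrow> z [^] m \<in> T \<Longrightarrow> z \<in> T"
    and "z \<in> ucs G T (Suc i)" "z [^] m \<in> ucs G T i"
  shows "z \<in> ucs G T i"
  using assms(3-)
proof (induction i arbitrary: z)
  case 0
  then show ?case using iso unfolding ucs.simps(1) by blast
next
  case (Suc i)
  note Zi = normal_ucs[OF T, of i]
  note inv_Zi = subgroup.m_inv_closed[OF normal_imp_subgroup[OF Zi]]
  note inv_ZS = subgroup.m_inv_closed[OF normal_imp_subgroup[OF normal_ucs[OF T, of "Suc i"]]]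
  have z: "z \<in> carrier G" using Suc.prems(1) ucs_carrier[OF T] by blast
  have "gcomm G z g \<in> ucs G T i" if g: "g \<in> carrier G" for g
  proof -
    interpret q: group_hom G "G Mod ucs G T i" "\<lambda>x. ucs G T i #> x" by (rule normal_quotient_hom[OF Zi])
    \<comment> \<open>This is the factor with \<open>c \<otimes> z\<close> equal to the conjugate of
      \<open>z\<close> by \<open>g\<close>. The \<open>m\<close>-th power is now computed twice: by
      distributing it over \<open>c \<otimes> z\<close>, and by conjugating
      \<open>z [^] m\<close>.\<close>
    define c where "c = inv (gcomm G z g)"
    have c: "c \<in> carrier G" using z g by (simp add: c_def)
    have cZ: "c \<in> ucs G T (Suc i)"
      using Suc.prems(1) g unfolding c_def by (intro inv_ZS) auto
    have cz: "c \<otimes> z = g \<otimes> z \<otimes> inv g" using z g by (simp add: c_def gcomm_def m_assoc inv_mult_group)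
    have "gcomm G c z \<in> ucs G T i" using cZ z by simp
    then have "ucs G T i #> (c \<otimes> z) [^] m = ucs G T i #> (c [^] m \<otimes> z [^] m)"
      using z c by (intro pow_mult_congruent[OF Zi])
    moreover have "(c \<otimes> z) [^] m = inv (gcomm G (z [^] m) g) \<otimes> z [^] m"
      unfolding cz conj_nat_pow[OF z g] using z g by (simp add: gcomm_def m_assoc inv_mult_group)
    moreover have "inv (gcomm G (z [^] m) g) \<in> ucs G T i"
      using Suc.prems(2) g by (intro inv_Zi) auto
    then have "ucs G T i #> inv (gcomm G (z [^] m) g) = \<one>\<^bsub>G Mod ucs G T i\<^esub>"
      using normal_quotient_eq_one[OF Zi] ucs_carrier[OF T] by blast
    ultimately have "\<one>\<^bsub>G Mod ucs G T i\<^esub> \<otimes>\<^bsub>G Mod ucs G T i\<^esub> (ucs G T i #> z [^] m) =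
        (ucs G T i #> c [^] m) \<otimes>\<^bsub>G Mod ucs G T i\<^esub> (ucs G T i #> z [^] m)"
      using z c g by (metis gcomm_closed inv_closed nat_pow_closed q.hom_mult)
    then have "ucs G T i #> c [^] m = \<one>\<^bsub>G Mod ucs G T i\<^esub>"
      using z c by (metis nat_pow_closed q.H.one_closed q.H.right_cancel q.hom_closed)
    then have "c [^] m \<in> ucs G T i"
      using c normal_quotient_eq_one[OF Zi] by (metis nat_pow_closed)
    then have "c \<in> ucs G T i" using Suc.IH cZ by blast
    then have "inv c \<in> ucs G T i" by (rule inv_Zi)
    then show ?thesis using z g by (simp add: c_def)
  qed
  then show ?case using z by simp
qed

text \<open>Nilpotency places \<open>z\<close> in layer \<open>n\<close>; the one-layer lemma then
  brings it down to layer \<open>i\<close>, since \<open>z [^] m\<close> lies in every layer in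
  between.\<close>

lemma ucs_isolated:
  fixes m :: nat
  assumes T: "T \<lhd> G" and iso: "\<And>z. z \<in> ucs G T (Suc 0) \<Longrightarrow> z [^] m \<in> T \<Longrightarrow> z \<in> T"
    and nil: "carrier G \<subseteq> ucs G T n" and z: "z \<in> carrier G" "z [^] m \<in> ucs G T i"
  shows "z \<in> ucs G T i"
proof (cases "i \<le> n")
  case True
  then show ?thesis
  proof (induction rule: inc_induct)
    case base
    then show ?case using nil z by blast
  next
    case (step k)
    have "z [^] m \<in> ucs G T k" using z(2) ucs_mono_index[OF T step.hyps(1)] by blast
    then show ?case using ucs_isolated_Suc[OF T iso step.IH] by blast
  qed
next
  case False
  then show ?thesis using nil z ucs_mono_index[OF T, of n i] by auto
qed

text \<open>The torsion elements are exactly the radical \<open>T\<close>: isolation at layer 0,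
  which is \<open>T\<close> itself, puts each of them into \<open>T\<close>.\<close>

lemma torsion_modulo_normal:
  fixes M :: "nat set"
  assumes S: "S \<lhd> G" and "1 \<in> M" "\<forall>m\<in>M. \<forall>n\<in>M. m * n \<in> M"
    and nil: "carrier G \<subseteq> ucs G S k"
  shows "{x \<in> carrier G. \<exists>m\<in>M. x [^] m \<in> S} \<lhd> G"
proof -
  obtain T where T: "T \<lhd> G" "S \<subseteq> T" "\<And>t. t \<in> T \<Longrightarrow> \<exists>m\<in>M. t [^] m \<in> S"
    "\<And>z m. z \<in> ucs G T (Suc 0) \<Longrightarrow> m \<in> M \<Longrightarrow> z [^] m \<in> T \<Longrightarrow> z \<in> T"
    using ex_torsion_radical[OF assms(1-3)] by metis
  have nilT: "carrier G \<subseteq> ucs G T k" using nil ucs_mono[OF T(2)] by blast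
  have "x \<in> T" if "x \<in> carrier G" "m \<in> M" "x [^] m \<in> S" for x m
  proof -
    have "x \<in> ucs G T 0"
      by (rule ucs_isolated[OF T(1) T(4)[OF _ \<open>m \<in> M\<close>] nilT]) (use that T(2) in auto)
    then show ?thesis by simp
  qed
  then have "{x \<in> carrier G. \<exists>m\<in>M. x [^] m \<in> S} = T"
    using T normal_imp_subgroup subgroup.subset by blast
  then show ?thesis using T(1) by simp
qed

text \<open>Passing from \<open>S\<close> to its radical \<open>T\<close> turns displacement up to
  torsion into exact congruence, so \<open>lcs_congruent_endomorphism\<close> applies with
  \<open>i = 0\<close>; membership in \<open>T\<close> is then read back as torsion modulo
  \<open>S\<close>.\<close>

lemma lcs_torsion_endomorphism:
  fixes M :: "nat set"
  assumes S: "S \<lhd> G" and "1 \<in> M" "\<forall>m\<in>M. \<forall>n\<in>M. m * n \<in> M"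
    and nil: "carrier G \<subseteq> ucs G S k" and \<phi>: "\<phi> \<in> hom G G"
    and tor: "\<And>x. x \<in> carrier G \<Longrightarrow> \<exists>m\<in>M. (inv x \<otimes> \<phi> x) [^] m \<in> ucs G S c"
    and x: "x \<in> lcs G c"
  shows "\<exists>m\<in>M. (inv x \<otimes> \<phi> x) [^] m \<in> S"
proof -
  obtain T where T: "T \<lhd> G" "S \<subseteq> T" "\<And>t. t \<in> T \<Longrightarrow> \<exists>m\<in>M. t [^] m \<in> S"
    "\<And>z m. z \<in> ucs G T (Suc 0) \<Longrightarrow> m \<in> M \<Longrightarrow> z [^] m \<in> T \<Longrightarrow> z \<in> T"
    using ex_torsion_radical[OF assms(1-3)] by metis
  have nilT: "carrier G \<subseteq> ucs G T k" using nil ucs_mono[OF T(2)] by blast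
  have "inv y \<otimes> \<phi> y \<in> ucs G T (0 + c)" if y: "y \<in> carrier G" for y
  proof -
    obtain m where m: "m \<in> M" "(inv y \<otimes> \<phi> y) [^] m \<in> ucs G S c" using tor[OF y] by blast
    have "inv y \<otimes> \<phi> y \<in> carrier G" using y \<phi> by (auto simp: hom_def)
    moreover have "(inv y \<otimes> \<phi> y) [^] m \<in> ucs G T c" using m(2) ucs_mono[OF T(2)] by blast
    moreover have "\<And>z. z \<in> ucs G T (Suc 0) \<Longrightarrow> z [^] m \<in> T \<Longrightarrow> z \<in> T" using T(4) m(1) by blast
    ultimately show ?thesis unfolding add_0 using ucs_isolated[OF T(1) _ nilT] by blast
  qed
  then have "inv x \<otimes> \<phi> x \<in> T"
    using lcs_congruent_endomorphism[OF T(1) \<phi> _ x, of 0] by simp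
  then show ?thesis by (rule T(3))
qed

text \<open>Conjugation by \<open>z\<close> is trivial modulo layer \<open>c\<close>, hence trivial
  modulo \<open>T\<close> on \<open>lcs G c\<close>. This will supply the commutativity of the Baer
  invariant.\<close>

lemma gcomm_lcs_ucs:
  assumes T: "T \<lhd> G" and x: "x \<in> lcs G c" and z: "z \<in> ucs G T c"
  shows "gcomm G x z \<in> T"
proof -
  note ZT = normal_ucs[OF T, of c]
  have xz: "x \<in> carrier G" "z \<in> carrier G"
    using x z ucs_carrier[OF T] normal_lcs normal_imp_subgroup subgroup.subset by blast+
  \<comment> \<open>The displacement of \<open>inv x\<close>, rather than of \<open>x\<close>, is
    the required commutator.\<close>
  have "inv (inv x) \<otimes> (z \<otimes> inv x \<otimes> inv z) \<in> ucs G T 0"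
  proof (rule lcs_congruent_endomorphism[OF T, where j = c and \<phi> = "\<lambda>y. z \<otimes> y \<otimes> inv z"])
    show "(\<lambda>y. z \<otimes> y \<otimes> inv z) \<in> hom G G" using xz by (auto simp: hom_def m_assoc)
    show "inv x \<in> lcs G c" by (rule subgroup.m_inv_closed[OF normal_imp_subgroup[OF normal_lcs] x])
    fix y assume y: "y \<in> carrier G"
    have "inv y \<otimes> gcomm G z y \<otimes> y \<in> ucs G T c"
      using y z by (intro normal_conj[OF ZT] gcomm_mem_normal[OF ZT])
    then show "inv y \<otimes> (z \<otimes> y \<otimes> inv z) \<in> ucs G T (0 + c)"
      using xz y by (simp add: gcomm_def m_assoc)
  qed
  then show ?thesis using xz by (simp add: gcomm_def m_assoc)
qed

end

section \<open>Sylow subgroups of finite nilpotent groups\<close>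

text \<open>The retraction is a power map whose exponent is 1 modulo \<open>p ^ a\<close> and 0
  modulo \<open>m\<close>, where the group has order \<open>p ^ a * m\<close>. It is multiplicative
  because the group is the product of its commuting \<open>p\<close>-part and
  prime-to-\<open>p\<close> part.\<close>

lemma (in group) nilpotent_sylow_retraction:
  assumes fin: "finite (carrier G)" and nil: "nilpotent_group G" and p: "Factorial_Ring.prime p"
    and P: "subgroup P G" "card P = p ^ multiplicity p (order G)"
  obtains e m where "e \<in> hom G G" "e ` carrier G \<subseteq> P" "\<And>x. x \<in> P \<Longrightarrow> e x = x"
    "coprime m p" "\<And>g. g \<in> carrier G \<Longrightarrow> (inv g \<otimes> e g) [^] (m::nat) = \<one>"
proof -
  define a where "a = multiplicity p (order G)"
  have ord0: "order G \<noteq> 0" using fin order_gt_0_iff_finite by simp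
  obtain m where ordG: "order G = p ^ a * m" and m: "\<not> p dvd m"
    using multiplicity_decompose'[of "order G" p] ord0 p unfolding a_def
    by (metis not_prime_unit)
  have cop: "coprime m p" using prime_imp_coprime[OF p m] by (simp add: coprime_commute)
  have m0: "m \<noteq> 0" using ord0 ordG by auto
  obtain x y where xy: "m * x = p ^ a * y + 1"
    using bezout_nat[OF m0, of "p ^ a"] cop by auto
  define u where "u = m * x"
  have one: "{\<one>} \<lhd> G" by (rule one_is_normal)
  obtain k where k: "lcs G k = {\<one>}" using nil by (auto simp: nilpotent_group_def)
  have ucs: "carrier G \<subseteq> ucs G {\<one>} k"
    using k by (intro subset_ucs_iter_comm[OF normal_carrier]) (simp add: lcs_def)
  \<comment> \<open>Elements of \<open>p\<close>-power order and of order prime to \<open>p\<close>,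
    phrased as torsion modulo the trivial subgroup; nilpotency makes both sets normal
    subgroups.\<close>
  define Tp where "Tp = {x \<in> carrier G. \<exists>n\<in>range (\<lambda>i. p ^ i). x [^] n \<in> {\<one>}}"
  define Tq where "Tq = {x \<in> carrier G. \<exists>n\<in>{n. coprime n p}. x [^] n \<in> {\<one>}}"
  have Tp: "Tp \<lhd> G" unfolding Tp_def
    by (rule torsion_modulo_normal[OF one _ _ ucs]) (auto simp flip: power_add intro: range_eqI[of _ _ 0])
  have Tq: "Tq \<lhd> G" unfolding Tq_def
    by (rule torsion_modulo_normal[OF one _ _ ucs]) auto
  \<comment> \<open>The exponent in the definition of \<open>Tp\<close> depends on \<open>z\<close>;
    Lagrange's theorem makes it uniform.\<close>
  have Tp_pow: "z [^] (p ^ a) = \<one>" if "z \<in> Tp" for z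
  proof -
    obtain i where z: "z \<in> carrier G" "z [^] (p ^ i) = \<one>" using \<open>z \<in> Tp\<close> by (auto simp: Tp_def)
    have "coprime (p ^ i) m" using cop by (simp add: coprime_commute)
    then have "coprime (ord z) m"
      using z pow_eq_id coprime_divisors dvd_refl by metis
    moreover have "ord z dvd p ^ a * m" using ord_dvd_group_order[OF z(1)] ordG by simp
    ultimately show ?thesis using z(1) by (simp add: pow_eq_id coprime_dvd_mult_left_iff)
  qed
  have Tq_pow: "z [^] m = \<one>" if "z \<in> Tq" for z
  proof -
    obtain n where z: "z \<in> carrier G" "z [^] n = \<one>" "coprime n p" using \<open>z \<in> Tq\<close> by (auto simp: Tq_def)
    have "coprime n (p ^ a)" using z by simp
    then have "coprime (ord z) (p ^ a)"
      using z pow_eq_id coprime_divisors dvd_refl by metis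
    moreover have "ord z dvd p ^ a * m" using ord_dvd_group_order[OF z(1)] ordG by simp
    ultimately show ?thesis using z(1) by (simp add: pow_eq_id coprime_dvd_mult_right_iff)
  qed
  have int: "z = \<one>" if "z \<in> Tp" "z \<in> Tq" for z
    using mem_normal_coprime_pow[OF one, of z "p ^ a" m] Tp_pow[OF that(1)] Tq_pow[OF that(2)] cop that
    by (auto simp: Tp_def coprime_commute)
  have commute: "b \<otimes> c = c \<otimes> b" if bc: "b \<in> Tp" "c \<in> Tq" for b c
  proof -
    have [simp]: "b \<in> carrier G" "c \<in> carrier G" using bc by (auto simp: Tp_def Tq_def)
    have "gcomm G b c \<in> Tp" using gcomm_mem_normal[OF Tp] bc by simp
    moreover have "gcomm G b c = inv (gcomm G c b)" by (simp add: gcomm_def inv_mult_group m_assoc)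
    then have "gcomm G b c \<in> Tq"
      using gcomm_mem_normal[OF Tq, of c b] bc subgroup.m_inv_closed[OF normal_imp_subgroup[OF Tq]] by simp
    ultimately have "gcomm G b c \<otimes> (c \<otimes> b) = c \<otimes> b" using int by simp
    then show ?thesis by (simp add: gcomm_def m_assoc)
  qed
  have e_Tp: "b [^] u = b" if "b \<in> Tp" for b
  proof -
    have b: "b \<in> carrier G" using that by (simp add: Tp_def)
    then have "b [^] u = (b [^] (p ^ a)) [^] y \<otimes> b"
      unfolding u_def xy by (simp add: nat_pow_pow)
    then show ?thesis using Tp_pow[OF that] b by simp
  qed
  have e_mult: "(b \<otimes> c) [^] u = b" if bc: "b \<in> Tp" "c \<in> Tq" for b c
  proof -
    have [simp]: "b \<in> carrier G" "c \<in> carrier G" using bc by (auto simp: Tp_def Tq_def)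
    have "(b \<otimes> c) [^] u = b [^] u \<otimes> c [^] u" by (simp add: pow_mult_distrib[OF commute[OF bc]])
    moreover have "c [^] u = (c [^] m) [^] x" by (simp add: u_def nat_pow_pow)
    ultimately show ?thesis using e_Tp[OF bc(1)] Tq_pow[OF bc(2)] by simp
  qed
  have e_in: "g [^] u \<in> Tp" if g: "g \<in> carrier G" for g
  proof -
    have "(g [^] u) [^] (p ^ a) = (g [^] order G) [^] x"
      using g by (simp add: nat_pow_pow u_def ordG ac_simps)
    then have "(g [^] u) [^] (p ^ a) = \<one>" using pow_order_eq_1 g by simp
    then show ?thesis using g by (auto simp: Tp_def)
  qed
  have compl: "g [^] u = g \<otimes> g [^] (p ^ a * y)" "(g [^] (p ^ a * y)) [^] m = \<one>" if g: "g \<in> carrier G" for g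
  proof -
    show "g [^] u = g \<otimes> g [^] (p ^ a * y)" using g unfolding u_def xy
      by (metis Suc_eq_plus1 nat_pow_Suc2)
    have "(g [^] (p ^ a * y)) [^] m = (g [^] order G) [^] y"
      using g by (simp add: nat_pow_pow ordG ac_simps)
    then show "(g [^] (p ^ a * y)) [^] m = \<one>" using pow_order_eq_1 g by simp
  qed
  \<comment> \<open>Both components are powers of \<open>g\<close>, read off from the Bezout
    relation.\<close>
  have decomp: "\<exists>b\<in>Tp. \<exists>c\<in>Tq. g = b \<otimes> c" if g: "g \<in> carrier G" for g
  proof (intro bexI)
    have "g [^] u = g [^] (p ^ a * y) \<otimes> g" using g unfolding u_def xy by simp
    then have "g [^] u = g \<otimes> g [^] (p ^ a * y)" using compl(1) g by simp
    then show "g = g [^] u \<otimes> inv (g [^] (p ^ a * y))" using g by (simp add: m_assoc)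
    have "(inv (g [^] (p ^ a * y))) [^] m = \<one>" using compl(2)[OF g] g by (simp add: nat_pow_inv)
    then show "inv (g [^] (p ^ a * y)) \<in> Tq" using g cop by (auto simp: Tq_def)
  qed (rule e_in[OF g])
  have hom: "(\<lambda>g. g [^] u) \<in> hom G G"
  proof (rule homI)
    fix g h assume "g \<in> carrier G" "h \<in> carrier G"
    then obtain b c b' c' where d: "b \<in> Tp" "c \<in> Tq" "g = b \<otimes> c" "b' \<in> Tp" "c' \<in> Tq" "h = b' \<otimes> c'"
      using decomp by metis
    then have [simp]: "b \<in> carrier G" "c \<in> carrier G" "b' \<in> carrier G" "c' \<in> carrier G"
      by (auto simp: Tp_def Tq_def)
    have "g \<otimes> h = b \<otimes> (c \<otimes> b') \<otimes> c'" by (simp add: d m_assoc)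
    also have "\<dots> = (b \<otimes> b') \<otimes> (c \<otimes> c')" using commute[OF d(4,2)] by (simp add: m_assoc flip: commute[OF d(4,2)])
    finally have "(g \<otimes> h) [^] u = b \<otimes> b'"
      using e_mult subgroup.m_closed[OF normal_imp_subgroup[OF Tp]]
        subgroup.m_closed[OF normal_imp_subgroup[OF Tq]] d by simp
    then show "(g \<otimes> h) [^] u = g [^] u \<otimes> h [^] u" using d e_mult by simp
  qed simp
  have "P \<subseteq> Tp"
  proof
    fix z assume z: "z \<in> P"
    interpret P: group "G\<lparr>carrier := P\<rparr>" using P(1) by (rule subgroup_imp_group)
    have "z [^] (p ^ a) = \<one>"
      using P.pow_order_eq_1[of z] z P(2) nat_pow_consistent by (simp add: order_def a_def)
    then show "z \<in> Tp" using z subgroup.subset[OF P(1)] by (auto simp: Tp_def)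
  qed
  moreover have finT: "finite Tp" using fin by (simp add: Tp_def)
  moreover have "card Tp \<le> card P"
  proof -
    have dvd: "card Tp dvd p ^ a * m"
      using lagrange[OF normal_imp_subgroup[OF Tp]] ordG by (metis dvd_triv_right)
    \<comment> \<open>Otherwise a prime \<open>q\<close> different from \<open>p\<close> divides
      \<open>card Tp\<close>, and Sylow's theorem with exponent 1 gives a subgroup of order
      \<open>q\<close> in \<open>Tp\<close>. Its nontrivial elements would be killed by both
      \<open>q\<close> and \<open>p ^ a\<close>.\<close>
    have "coprime (card Tp) m"
    proof (rule ccontr)
      assume "\<not> coprime (card Tp) m"
      then obtain d where d: "d dvd card Tp" "d dvd m" "\<not> is_unit d" by (auto elim: not_coprimeE)
      then have "d \<noteq> 1" by auto
      then obtain q where q: "Factorial_Ring.prime q" "q dvd d" using prime_factor_nat by blast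
      have "q \<noteq> p" using q(2) d(2) m dvd_trans by metis
      then have qp: "coprime q p" using q(1) p by (simp add: primes_coprime)
      obtain r where r: "card Tp = q * r" using q(2) d(1) by (meson dvdE dvd_trans)
      interpret T: group "G\<lparr>carrier := Tp\<rparr>"
        using normal_imp_subgroup[OF Tp] by (rule subgroup_imp_group)
      obtain H where H: "subgroup H (G\<lparr>carrier := Tp\<rparr>)" "card H = q ^ 1"
        using sylow_thm[OF q(1) T.group_axioms, of 1 r] r finT by (auto simp: order_def)
      interpret H: group "G\<lparr>carrier := Tp\<rparr>\<lparr>carrier := H\<rparr>"
        using H(1) by (rule T.subgroup_imp_group)
      have "card H > 1" using H(2) q(1) prime_gt_1_nat by simp
      then obtain z where z: "z \<in> H" "z \<noteq> \<one>"
        by (metis One_nat_def card.empty card_1_singleton_iff is_singletonI' is_singleton_altdef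
            less_numeral_extra(4) not_one_less_zero)
      have zT: "z \<in> Tp" using z subgroup.subset[OF H(1)] by auto
      have "z [^] q = \<one>"
        using H.pow_order_eq_1[of z] z H(2) by (simp add: order_def nat_pow_def)
      moreover have "coprime q (p ^ a)" using qp by simp
      ultimately have "z \<in> {\<one>}"
        using mem_normal_coprime_pow[OF one, of z q "p ^ a"] Tp_pow[OF zT] zT by (auto simp: Tp_def)
      then show False using z by simp
    qed
    then have "card Tp dvd p ^ a" using dvd by (simp add: coprime_dvd_mult_left_iff)
    then show ?thesis using P(2) p by (simp add: a_def dvd_imp_le prime_gt_0_nat)
  qed
  ultimately have TP: "P = Tp" using card_seteq by blast
  show thesis
  proof (rule that[OF hom])
    show "(\<lambda>g. g [^] u) ` carrier G \<subseteq> P" using e_in TP by auto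
    show "coprime m p" by (fact cop)
    show "(inv g \<otimes> g [^] u) [^] m = \<one>" if "g \<in> carrier G" for g
      using compl[OF that] that by simp
  qed (use e_Tp TP in simp)
qed

section \<open>Free groups\<close>

lemma inv_letter_inv_letter [simp]: "inv_letter (inv_letter l) = l"
  by (simp add: inv_letter_def)

lemma reduced_tl: "reduced (l # w) \<Longrightarrow> reduced w"
  by (cases w) auto

lemma reduced_reduce_cons: "reduced w \<Longrightarrow> reduced (reduce_cons l w)"
  by (auto simp: reduce_cons_def split: list.split dest: reduced_tl)

lemma reduce_cons_eq_Cons: "reduced (l # w) \<Longrightarrow> reduce_cons l w = l # w"
  by (auto simp: reduce_cons_def split: list.split)

text \<open>Van der Waerden's argument: letters act on reduced words, and inverse letters act
  inversely. When \<open>l\<close> cancels the head of \<open>w\<close>, reducedness prevents the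
  restored letter from cancelling again.\<close>

lemma reduce_cons_inv_letter:
  assumes "reduced w"
  shows "reduce_cons (inv_letter l) (reduce_cons l w) = w"
proof (cases w)
  case Nil
  then show ?thesis by (simp add: reduce_cons_def)
next
  case (Cons m v)
  show ?thesis
  proof (cases "m = inv_letter l")
    case True
    then have "reduce_cons (inv_letter l) v = inv_letter l # v"
      using assms Cons by (intro reduce_cons_eq_Cons) simp
    then show ?thesis using Cons True by (simp add: reduce_cons_def)
  next
    case False
    then show ?thesis using Cons by (simp add: reduce_cons_def)
  qed
qed

lemma reduced_foldr: "reduced w \<Longrightarrow> reduced (foldr reduce_cons u w)"
  by (induction u) (auto intro: reduced_reduce_cons)

lemma reduced_reduce: "reduced (reduce w)"
  by (simp add: reduce_def reduced_foldr)

lemma reduce_append: "reduce (u @ v) = foldr reduce_cons u (reduce v)"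
  by (simp add: reduce_def)

lemma reduce_Nil [simp]: "reduce [] = []"
  and reduce_Cons: "reduce (l # w) = reduce_cons l (reduce w)"
  by (simp_all add: reduce_def)

lemma reduce_reduced: "reduced w \<Longrightarrow> reduce w = w"
proof (induction w)
  case (Cons l w)
  then show ?case using reduced_tl[OF Cons.prems] by (simp add: reduce_Cons reduce_cons_eq_Cons)
qed simp

text \<open>A cancellation in the acting word does not change its action on reduced words. Hence a
  word acts as its reduction does, which gives associativity in the free group.\<close>

lemma foldr_reduce_cons:
  assumes "reduced w"
  shows "foldr reduce_cons (reduce_cons l u) w = reduce_cons l (foldr reduce_cons u w)"
proof (cases u)
  case Nil
  then show ?thesis by (simp add: reduce_cons_def)
next
  case (Cons m v)
  have "reduce_cons (inv_letter (inv_letter l)) (reduce_cons (inv_letter l) (foldr reduce_cons v w))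
      = foldr reduce_cons v w"
    by (rule reduce_cons_inv_letter[OF reduced_foldr[OF assms]])
  moreover have "reduce_cons l u = (if m = inv_letter l then v else l # u)"
    using Cons by (simp add: reduce_cons_def)
  ultimately show ?thesis using Cons by auto
qed

lemma foldr_reduce: "reduced w \<Longrightarrow> foldr reduce_cons (reduce u) w = foldr reduce_cons u w"
  by (induction u) (auto simp: reduce_Cons foldr_reduce_cons)

lemma reduce_reduce_append:
  "reduce (reduce u @ v) = reduce (u @ v)" "reduce (u @ reduce v) = reduce (u @ v)"
  by (simp_all add: reduce_append foldr_reduce reduced_reduce reduce_reduced)

lemma set_reduce_subset: "set (reduce w) \<subseteq> set w"
proof (induction w)
  case (Cons l w)
  have "set (reduce_cons l (reduce w)) \<subseteq> insert l (set (reduce w))"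
    by (auto simp: reduce_cons_def split: list.splits if_splits)
  then show ?case using Cons by (auto simp: reduce_Cons)
qed simp

lemma reduce_inverse_word: "reduce (rev (map inv_letter w) @ w) = []"
proof (induction w)
  case (Cons l w)
  then show ?case
    using reduce_cons_inv_letter[OF reduced_reduce, of l w]
    by (simp add: reduce_append reduce_Cons)
qed simp

lemma group_free_group: "group (free_group S)"
proof (rule groupI)
  fix u v w
  assume u: "u \<in> carrier (free_group S)" and v: "v \<in> carrier (free_group S)"
  show "u \<otimes>\<^bsub>free_group S\<^esub> v \<in> carrier (free_group S)"
    using u v set_reduce_subset[of "u @ v"] by (force simp: free_group_def reduced_reduce)
  show "u \<otimes>\<^bsub>free_group S\<^esub> v \<otimes>\<^bsub>free_group S\<^esub> w = u \<otimes>\<^bsub>free_group S\<^esub> (v \<otimes>\<^bsub>free_group S\<^esub> w)"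
    by (simp add: free_group_def reduce_reduce_append)
  show "\<one>\<^bsub>free_group S\<^esub> \<otimes>\<^bsub>free_group S\<^esub> u = u"
    using u by (simp add: free_group_def reduce_reduced)
  show "\<exists>y\<in>carrier (free_group S). y \<otimes>\<^bsub>free_group S\<^esub> u = \<one>\<^bsub>free_group S\<^esub>"
  proof
    \<comment> \<open>Reducing the formal inverse puts it into the carrier at once.\<close>
    show "reduce (rev (map inv_letter u)) \<otimes>\<^bsub>free_group S\<^esub> u = \<one>\<^bsub>free_group S\<^esub>"
      by (simp add: free_group_def reduce_reduce_append reduce_inverse_word)
    show "reduce (rev (map inv_letter u)) \<in> carrier (free_group S)"
      using u set_reduce_subset[of "rev (map inv_letter u)"]
      by (force simp: free_group_def reduced_reduce inv_letter_def)
  qed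
qed (simp add: free_group_def)

text \<open>The homomorphism of free groups induced by a map of generators. Renaming is followed by
  reduction because \<open>f\<close> may identify generators and so create cancellations.\<close>

definition rename_word :: "('x \<Rightarrow> 'y) \<Rightarrow> ('x \<times> bool) list \<Rightarrow> ('y \<times> bool) list" where
  "rename_word f w = reduce (map (apfst f) w)"

text \<open>Renaming sends inverse letters to inverse letters, so cancellations made beforehand are
  absorbed by the final reduction.\<close>

lemma rename_word_reduce: "rename_word f (reduce w) = rename_word f w"
proof (induction w)
  case (Cons l w)
  have "rename_word f (reduce_cons l v) = reduce_cons (apfst f l) (rename_word f v)" for v
  proof (cases "\<exists>v'. v = inv_letter l # v'")
    case True
    then obtain v' where v: "v = inv_letter l # v'" by blast
    then have "reduce_cons l v = v'" by (simp add: reduce_cons_def)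
    then show ?thesis
      using reduce_cons_inv_letter[OF reduced_reduce, of "apfst f (inv_letter l)" "map (apfst f) v'"]
      by (cases l) (simp add: v rename_word_def reduce_Cons inv_letter_def)
  next
    case False
    then have "reduce_cons l v = l # v" by (auto simp: reduce_cons_def split: list.split)
    then show ?thesis by (simp add: rename_word_def reduce_Cons)
  qed
  then show ?case using Cons by (simp add: reduce_Cons) (simp add: rename_word_def reduce_Cons)
qed simp

lemma rename_word_hom:
  assumes "f ` S \<subseteq> T"
  shows "group_hom (free_group S) (free_group T) (rename_word f)"
proof -
  have "rename_word f w \<in> carrier (free_group T)" if "w \<in> carrier (free_group S)" for w
    using that assms set_reduce_subset[of "map (apfst f) w"]
    by (force simp: rename_word_def free_group_def reduced_reduce)
  moreover have "rename_word f (reduce (u @ v)) = reduce (rename_word f u @ rename_word f v)" for u v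
    by (simp add: rename_word_reduce) (simp add: rename_word_def reduce_reduce_append)
  ultimately have "rename_word f \<in> hom (free_group S) (free_group T)"
    by (intro homI) (auto simp: free_group_def)
  then show ?thesis by (simp add: group_hom_def group_hom_axioms_def group_free_group)
qed

lemma rename_word_fixed:
  assumes "w \<in> carrier (free_group S)" "\<And>x. x \<in> S \<Longrightarrow> f x = x"
  shows "rename_word f w = w"
proof -
  have "map (apfst f) w = w"
    using assms by (intro map_idI) (force simp: free_group_def prod_eq_iff)
  then show ?thesis using assms by (simp add: rename_word_def reduce_reduced free_group_def)
qed

section \<open>Evaluation of words\<close>

context group
begin

lemma eval_word_Nil [simp]: "eval_word G [] = \<one>"
  and eval_word_Cons: "eval_word G (l # w) = (if snd l then fst l else inv (fst l)) \<otimes> eval_word G w"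
  by (simp_all add: eval_word_def)

lemma eval_word_closed: "fst ` set w \<subseteq> carrier G \<Longrightarrow> eval_word G w \<in> carrier G"
  by (induction w) (auto simp: eval_word_Cons)

lemma eval_word_append:
  assumes "fst ` set u \<subseteq> carrier G" "fst ` set v \<subseteq> carrier G"
  shows "eval_word G (u @ v) = eval_word G u \<otimes> eval_word G v"
  using assms by (induction u) (auto simp: eval_word_Cons eval_word_closed m_assoc)

lemma eval_word_reduce:
  assumes "fst ` set w \<subseteq> carrier G"
  shows "eval_word G (reduce w) = eval_word G w"
  using assms
proof (induction w)
  case (Cons l w)
  have rw: "fst ` set (reduce w) \<subseteq> carrier G" using Cons.prems set_reduce_subset[of w] by force
  have "eval_word G (reduce_cons l v) = eval_word G (l # v)"
    if "fst ` set v \<subseteq> carrier G" for v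
    using that Cons.prems eval_word_closed[of "tl v"]
    by (auto simp: reduce_cons_def eval_word_Cons inv_letter_def split: list.split)
  then show ?case using Cons rw by (simp add: reduce_Cons eval_word_Cons)
qed simp

lemma eval_word_hom: "group_hom (free_group (carrier G)) G (eval_word G)"
proof -
  have "eval_word G \<in> hom (free_group (carrier G)) G"
  proof (rule homI)
    fix u v assume "u \<in> carrier (free_group (carrier G))" "v \<in> carrier (free_group (carrier G))"
    then have u: "fst ` set u \<subseteq> carrier G" and v: "fst ` set v \<subseteq> carrier G"
      by (simp_all add: free_group_def)
    show "eval_word G u \<in> carrier G" by (rule eval_word_closed[OF u])
    have "eval_word G (reduce (u @ v)) = eval_word G (u @ v)"
      using u v by (intro eval_word_reduce) auto
    then show "eval_word G (u \<otimes>\<^bsub>free_group (carrier G)\<^esub> v) = eval_word G u \<otimes> eval_word G v"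
      using eval_word_append[OF u v] by (simp add: free_group_def)
  qed
  then show ?thesis by (simp add: group_hom_def group_hom_axioms_def group_free_group is_group)
qed

text \<open>The generators are the group elements themselves, so renaming by \<open>e\<close> lifts
  \<open>e\<close> to the free presentation.\<close>

lemma eval_word_rename_word:
  assumes e: "e \<in> hom G G" and "fst ` set w \<subseteq> carrier G"
  shows "eval_word G (rename_word e w) = e (eval_word G w)"
proof -
  interpret e: group_hom G G e using e by (simp add: group_hom_def group_hom_axioms_def)
  have "eval_word G (map (apfst e) w) = e (eval_word G w)"
    using assms(2) by (induction w) (auto simp: eval_word_Cons eval_word_closed)
  moreover have "fst ` set (map (apfst e) w) \<subseteq> carrier G" using assms(2) by auto
  ultimately show ?thesis by (simp add: rename_word_def eval_word_reduce)
qed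

lemma eval_word_subgroup:
  assumes "subgroup P G" "fst ` set w \<subseteq> P"
  shows "eval_word (G\<lparr>carrier := P\<rparr>) w = eval_word G w"
  using assms(2) by (induction w) (auto simp: eval_word_def m_inv_consistent[OF assms(1)])

end

section \<open>The canonical free presentation\<close>

context group
begin

lemma group_pres_F: "group (pres_F G)"
  by (simp add: pres_F_def group_free_group)

lemma pres_F_eval_hom: "group_hom (pres_F G) G (eval_word G)"
  by (simp add: pres_F_def eval_word_hom)

lemma normal_pres_R: "pres_R G \<lhd> pres_F G"
  unfolding pres_R_def by (rule group_hom.normal_kernel[OF pres_F_eval_hom])

lemma mem_pres_R:
  "w \<in> pres_R G \<longleftrightarrow> w \<in> carrier (pres_F G) \<and> eval_word G w = \<one>"
  by (auto simp: pres_R_def kernel_def)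

lemma pres_R_subset_ucs:
  "pres_R G \<subseteq> ucs (pres_F G) (iter_comm (pres_F G) (pres_R G) c) c"
  by (rule group.subset_ucs_iter_comm[OF group_pres_F normal_pres_R order_refl])

text \<open>Evaluation sends \<open>lcs (pres_F G) k\<close> to the identity, so this term consists
  of relations. Stacking \<open>k\<close> layers on the relations, which lie in layer
  \<open>c\<close>, gives layer \<open>c + k\<close>.\<close>

lemma pres_F_subset_ucs:
  assumes "lcs G k = {\<one>}"
  shows "carrier (pres_F G) \<subseteq> ucs (pres_F G) (iter_comm (pres_F G) (pres_R G) c) (c + k)"
proof -
  interpret F: group "pres_F G" by (rule group_pres_F)
  interpret ev: group_hom "pres_F G" G "eval_word G" by (rule pres_F_eval_hom)
  have "eval_word G ` lcs (pres_F G) k \<subseteq> lcs G k"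
    unfolding lcs_def
    by (rule F.iter_comm_hom_image[OF pres_F_eval_hom F.normal_carrier]) auto
  then have "lcs (pres_F G) k \<subseteq> pres_R G"
    using assms subgroup.subset[OF normal_imp_subgroup[OF F.normal_lcs[of k]]]
    unfolding mem_pres_R subset_iff by blast
  then have "carrier (pres_F G) \<subseteq> ucs (pres_F G) (pres_R G) k"
    by (intro F.subset_ucs_iter_comm[OF F.normal_carrier]) (simp add: lcs_def)
  also have "\<dots> \<subseteq> ucs (pres_F G) (ucs (pres_F G) (iter_comm (pres_F G) (pres_R G) c) c) k"
    by (rule F.ucs_mono[OF pres_R_subset_ucs])
  finally show ?thesis unfolding F.ucs_ucs .
qed

text \<open>The trivial endomorphism displaces \<open>y\<close> by its inverse, whose
  \<open>n\<close>-th power is a relation and so lies in layer \<open>c\<close>; the exponents are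
  the powers of \<open>n\<close>.\<close>

lemma lcs_pres_F_torsion:
  fixes n :: nat
  assumes k: "lcs G k = {\<one>}" and n: "\<And>g. g \<in> carrier G \<Longrightarrow> g [^] n = \<one>"
    and x: "x \<in> lcs (pres_F G) c"
  shows "\<exists>j. x [^]\<^bsub>pres_F G\<^esub> (n ^ j) \<in> iter_comm (pres_F G) (pres_R G) c"
proof -
  interpret F: group "pres_F G" by (rule group_pres_F)
  interpret ev: group_hom "pres_F G" G "eval_word G" by (rule pres_F_eval_hom)
  let ?S = "iter_comm (pres_F G) (pres_R G) c"
  have S: "?S \<lhd> pres_F G" by (rule F.normal_iter_comm[OF normal_pres_R])
  have xF: "x \<in> carrier (pres_F G)"
    using x subgroup.subset[OF normal_imp_subgroup[OF F.normal_lcs]] by blast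
  have "\<exists>m\<in>range ((^) n). (inv\<^bsub>pres_F G\<^esub> x \<otimes>\<^bsub>pres_F G\<^esub> \<one>\<^bsub>pres_F G\<^esub>) [^]\<^bsub>pres_F G\<^esub> m \<in> ?S"
  proof (rule F.lcs_torsion_endomorphism[OF S _ _ pres_F_subset_ucs[OF k] _ _ x, where \<phi> = "\<lambda>_. \<one>\<^bsub>pres_F G\<^esub>"])
    show "1 \<in> range ((^) n)" by (rule range_eqI[of _ _ 0]) simp
    show "\<forall>i\<in>range ((^) n). \<forall>j\<in>range ((^) n). i * j \<in> range ((^) n)"
      by (auto simp flip: power_add)
    show "(\<lambda>_. \<one>\<^bsub>pres_F G\<^esub>) \<in> hom (pres_F G) (pres_F G)" by (simp add: hom_def)
    fix y assume y: "y \<in> carrier (pres_F G)"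
    have "eval_word G ((inv\<^bsub>pres_F G\<^esub> y) [^]\<^bsub>pres_F G\<^esub> (n ^ 1)) = \<one>"
      using y n[of "inv (eval_word G y)"] by (simp add: ev.hom_nat_pow)
    then have "(inv\<^bsub>pres_F G\<^esub> y \<otimes>\<^bsub>pres_F G\<^esub> \<one>\<^bsub>pres_F G\<^esub>) [^]\<^bsub>pres_F G\<^esub> (n ^ 1) \<in> pres_R G"
      using y by (simp add: mem_pres_R)
    then show "\<exists>m\<in>range ((^) n). (inv\<^bsub>pres_F G\<^esub> y \<otimes>\<^bsub>pres_F G\<^esub> \<one>\<^bsub>pres_F G\<^esub>) [^]\<^bsub>pres_F G\<^esub> m
        \<in> ucs (pres_F G) ?S c"
      using pres_R_subset_ucs by blast
  qed
  then obtain j where "inv\<^bsub>pres_F G\<^esub> (x [^]\<^bsub>pres_F G\<^esub> (n ^ j)) \<in> ?S"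
    using xF by (auto simp: F.nat_pow_inv)
  then have "inv\<^bsub>pres_F G\<^esub> (inv\<^bsub>pres_F G\<^esub> (x [^]\<^bsub>pres_F G\<^esub> (n ^ j))) \<in> ?S"
    by (rule subgroup.m_inv_closed[OF normal_imp_subgroup[OF S]])
  then show ?thesis using xF by auto
qed

end

section \<open>The Baer invariant of a finite nilpotent group\<close>

theorem theorem4p3:
  fixes G :: "('a, 'b) monoid_scheme" and c p :: nat and P :: "'a set"
  assumes "c \<ge> 1"
    and "Factorial_Ring.prime (c + 1) \<or> c + 1 = 4"
    and "group G" and "finite (carrier G)" and "nilpotent_group G"
    and "Factorial_Ring.prime p"
    and "subgroup P G" and "card P = p ^ multiplicity p (order G)"
  shows "sylow_part p (baer_invariant c G) \<cong> baer_invariant c (G\<lparr>carrier := P\<rparr>)"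
proof -
  define a where "a = multiplicity p (order G)"
  define K where "K = G\<lparr>carrier := P\<rparr>"
  interpret G: group G by fact
  interpret K: group K unfolding K_def using assms(7) by (rule G.subgroup_imp_group)
  have PG: "P \<subseteq> carrier G" by (rule subgroup.subset[OF assms(7)])
  obtain e m where e: "e \<in> hom G G" and eP: "e ` carrier G \<subseteq> P" and eid: "\<And>x. x \<in> P \<Longrightarrow> e x = x"
    and m: "coprime m p" and em: "\<And>g. g \<in> carrier G \<Longrightarrow> (inv\<^bsub>G\<^esub> g \<otimes>\<^bsub>G\<^esub> e g) [^]\<^bsub>G\<^esub> (m::nat) = \<one>\<^bsub>G\<^esub>"
    using G.nilpotent_sylow_retraction[OF assms(4-8)] by blast
  obtain k where k: "lcs G k = {\<one>\<^bsub>G\<^esub>}" using assms(5) by (auto simp: nilpotent_group_def)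

  have incl: "group_hom K G (\<lambda>x. x)"
    by (auto simp: K_def group_hom_def group_hom_axioms_def hom_def
        G.subgroup_imp_group[OF assms(7)] intro: subsetD[OF PG])
  have "lcs K k \<subseteq> lcs G k"
    unfolding lcs_def
    using K.iter_comm_hom_image[OF incl K.normal_carrier, of "carrier G" k] PG by (simp add: K_def)
  then have kK: "lcs K k = {\<one>\<^bsub>K\<^esub>}"
    using k subgroup.one_closed[OF normal_imp_subgroup[OF K.normal_lcs]] by (auto simp: K_def)

  \<comment> \<open>Comparison of the free presentations of the group and of its Sylow
    subgroup\<close>
  define F where "F = pres_F G"
  define A where "A = pres_F K"
  define R where "R = pres_R G"
  define RA where "RA = pres_R K"
  define S where "S = iter_comm F R c"
  define SA where "SA = iter_comm A RA c"
  define \<epsilon> where "\<epsilon> = rename_word e"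
  have AP: "A = free_group P" by (simp add: A_def K_def pres_F_def)
  have FG: "F = free_group (carrier G)" by (simp add: F_def pres_F_def)
  interpret F: group F unfolding F_def by (rule G.group_pres_F)
  interpret A: group A unfolding A_def by (rule K.group_pres_F)
  \<comment> \<open>Words over \<open>P\<close> are words over the group with the same product, so
    the embedding of free groups is the identity on words.\<close>
  have AF: "carrier A \<subseteq> carrier F" using PG by (auto simp: AP FG free_group_def)
  have multA: "(\<otimes>\<^bsub>A\<^esub>) = (\<otimes>\<^bsub>F\<^esub>)" by (simp add: AP FG free_group_def)
  have inclF: "group_hom A F (\<lambda>x. x)"
    using AF by (auto simp: group_hom_def group_hom_axioms_def hom_def A.group_axioms F.group_axioms multA)
  interpret ev: group_hom F G "eval_word G" unfolding F_def by (rule G.pres_F_eval_hom)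
  \<comment> \<open>The same map is used twice: as a retraction onto \<open>A\<close> it transports
    commutator subgroups, as an endomorphism of \<open>F\<close> it has displacements.\<close>
  interpret \<epsilon>A: group_hom F A \<epsilon>
    unfolding \<epsilon>_def AP FG by (rule rename_word_hom[OF eP])
  interpret \<epsilon>: group_hom F F \<epsilon>
    unfolding \<epsilon>_def FG using eP PG by (intro rename_word_hom) blast
  have \<epsilon>_id: "\<epsilon> w = w" if "w \<in> carrier A" for w
    using that eid unfolding \<epsilon>_def AP by (rule rename_word_fixed)
  have ev\<epsilon>: "eval_word G (\<epsilon> w) = e (eval_word G w)" if "w \<in> carrier F" for w
    using that unfolding \<epsilon>_def FG by (intro G.eval_word_rename_word[OF e]) (simp add: free_group_def)
  have RA_iff: "w \<in> RA \<longleftrightarrow> w \<in> carrier A \<and> w \<in> R" for w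
    using AF G.eval_word_subgroup[OF assms(7), of w] K.mem_pres_R[of w] G.mem_pres_R[of w]
    unfolding RA_def R_def A_def[symmetric] F_def[symmetric]
    by (auto simp: AP free_group_def K_def)
  have RN: "R \<lhd> F" unfolding R_def F_def by (rule G.normal_pres_R)
  have RAN: "RA \<lhd> A" unfolding RA_def A_def by (rule K.normal_pres_R)
  have SN: "S \<lhd> F" unfolding S_def by (rule F.normal_iter_comm[OF RN])
  have SAN: "SA \<lhd> A" unfolding SA_def by (rule A.normal_iter_comm[OF RAN])
  have e_one: "e \<one>\<^bsub>G\<^esub> = \<one>\<^bsub>G\<^esub>" using eid subgroup.one_closed[OF assms(7)] by simp
  have \<epsilon>R: "\<epsilon> ` R \<subseteq> RA"
  proof (rule image_subsetI)
    fix w assume "w \<in> R"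
    then have w: "w \<in> carrier F" "eval_word G w = \<one>\<^bsub>G\<^esub>"
      using G.mem_pres_R[of w] by (auto simp: R_def F_def)
    then have "eval_word G (\<epsilon> w) = \<one>\<^bsub>G\<^esub>" using ev\<epsilon> e_one by simp
    then have "\<epsilon> w \<in> R" using w G.mem_pres_R[of "\<epsilon> w"] \<epsilon>.hom_closed by (auto simp: R_def F_def)
    then show "\<epsilon> w \<in> RA" using w by (simp add: RA_iff)
  qed
  have \<epsilon>S: "\<epsilon> ` S \<subseteq> SA"
    unfolding S_def SA_def by (rule F.iter_comm_hom_image[OF \<epsilon>A.group_hom_axioms RN \<epsilon>R])
  have SA_S: "SA \<subseteq> S"
    using A.iter_comm_hom_image[OF inclF RAN, of R c] RA_iff unfolding S_def SA_def by auto
  have lcsA: "lcs A c \<subseteq> lcs F c"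
    using A.iter_comm_hom_image[OF inclF A.normal_carrier, of "carrier F" c] AF unfolding lcs_def by auto
  have \<epsilon>_lcs: "\<epsilon> ` lcs F c \<subseteq> lcs A c"
    unfolding lcs_def by (rule F.iter_comm_hom_image[OF \<epsilon>A.group_hom_axioms F.normal_carrier]) auto
  have lcsFc: "lcs F c \<subseteq> carrier F"
    by (rule subgroup.subset[OF normal_imp_subgroup[OF F.normal_lcs]])
  have R_ucs: "R \<subseteq> ucs F S c"
    unfolding R_def F_def S_def by (rule G.pres_R_subset_ucs)
  have S_sub: "S \<subseteq> R \<inter> lcs F c"
  proof -
    have "(\<lambda>x. x) ` iter_comm F R c \<subseteq> iter_comm F (carrier F) c"
      using subgroup.subset[OF normal_imp_subgroup[OF RN]]
      by (intro F.iter_comm_hom_image[OF _ RN])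
         (auto simp: group_hom_def group_hom_axioms_def hom_def F.group_axioms)
    then show ?thesis using F.iter_comm_subset[OF RN, of c] by (auto simp: S_def lcs_def)
  qed

  \<comment> \<open>The retraction on \<open>p\<close>-torsion\<close>
  have key: "inv\<^bsub>F\<^esub> x \<otimes>\<^bsub>F\<^esub> \<epsilon> x \<in> S"
    if x: "x \<in> R" "x \<in> lcs F c" and xp: "x [^]\<^bsub>F\<^esub> (p ^ j) \<in> S" for x j
  proof -
    have xF: "x \<in> carrier F" using x lcsFc by blast
    have "\<exists>i\<in>{i. coprime i p}. (inv\<^bsub>F\<^esub> x \<otimes>\<^bsub>F\<^esub> \<epsilon> x) [^]\<^bsub>F\<^esub> i \<in> S"
    proof (rule F.lcs_torsion_endomorphism[OF SN _ _ _ \<epsilon>.homh _ x(2)])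
      show "carrier F \<subseteq> ucs F S (c + k)"
        unfolding F_def S_def R_def by (rule G.pres_F_subset_ucs[OF k])
      fix y assume y: "y \<in> carrier F"
      have "eval_word G ((inv\<^bsub>F\<^esub> y \<otimes>\<^bsub>F\<^esub> \<epsilon> y) [^]\<^bsub>F\<^esub> m) = \<one>\<^bsub>G\<^esub>"
        using y em[of "eval_word G y"] by (simp add: ev.hom_nat_pow ev\<epsilon>)
      then have "(inv\<^bsub>F\<^esub> y \<otimes>\<^bsub>F\<^esub> \<epsilon> y) [^]\<^bsub>F\<^esub> m \<in> R"
        using y G.mem_pres_R by (simp add: R_def flip: F_def)
      then show "\<exists>i\<in>{i. coprime i p}. (inv\<^bsub>F\<^esub> y \<otimes>\<^bsub>F\<^esub> \<epsilon> y) [^]\<^bsub>F\<^esub> i \<in> ucs F S c"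
        using m R_ucs by blast
    qed auto
    then obtain i where i: "coprime i p" "(inv\<^bsub>F\<^esub> x \<otimes>\<^bsub>F\<^esub> \<epsilon> x) [^]\<^bsub>F\<^esub> i \<in> S" by blast
    \<comment> \<open>The displacement is also killed by a power of \<open>p\<close>, because both
      \<open>x\<close> and its image are. Its two factors commute modulo \<open>S\<close>: one lies
      in the lower central term, the other is a relation.\<close>
    have "(inv\<^bsub>F\<^esub> x \<otimes>\<^bsub>F\<^esub> \<epsilon> x) [^]\<^bsub>F\<^esub> (p ^ j) \<in> S"
    proof (rule F.pow_mult_mem_normal[OF SN])
      have "\<epsilon> x \<in> R" using \<epsilon>R x(1) RA_iff by blast
      then show "gcomm F (inv\<^bsub>F\<^esub> x) (\<epsilon> x) \<in> S"
        using x R_ucs subgroup.m_inv_closed[OF normal_imp_subgroup[OF F.normal_lcs]]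
        by (intro F.gcomm_lcs_ucs[OF SN]) auto
      show "(inv\<^bsub>F\<^esub> x) [^]\<^bsub>F\<^esub> (p ^ j) \<in> S"
        using xF subgroup.m_inv_closed[OF normal_imp_subgroup[OF SN] xp] by (simp add: F.nat_pow_inv)
      have "\<epsilon> (x [^]\<^bsub>F\<^esub> (p ^ j)) \<in> S" using xp \<epsilon>S SA_S by blast
      then show "(\<epsilon> x) [^]\<^bsub>F\<^esub> (p ^ j) \<in> S" using xF by (simp add: \<epsilon>.hom_nat_pow)
    qed (use xF in simp_all)
    moreover have "coprime i (p ^ j)" using i(1) by simp
    moreover have "inv\<^bsub>F\<^esub> x \<otimes>\<^bsub>F\<^esub> \<epsilon> x \<in> carrier F" using xF by simp
    ultimately show ?thesis
      using F.mem_normal_coprime_pow[OF SN _ i(2)] by blast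
  qed

  \<comment> \<open>The map induced on Baer invariants\<close>
  define Q where "Q = F\<lparr>carrier := R \<inter> lcs F c\<rparr>"
  define QA where "QA = A\<lparr>carrier := RA \<inter> lcs A c\<rparr>"
  have sub: "subgroup (R \<inter> lcs F c) F"
    by (intro F.subgroups_Inter_pair normal_imp_subgroup RN F.normal_lcs)
  have subA: "subgroup (RA \<inter> lcs A c) A"
    by (intro A.subgroups_Inter_pair normal_imp_subgroup RAN A.normal_lcs)
  interpret Q: group Q unfolding Q_def by (rule F.subgroup_imp_group[OF sub])
  interpret QA: group QA unfolding QA_def by (rule A.subgroup_imp_group[OF subA])
  have SQ: "S \<lhd> Q" unfolding Q_def by (rule F.normal_restrict_supergroup[OF sub SN S_sub])
  interpret q: group_hom Q "Q Mod S" "\<lambda>x. S #>\<^bsub>Q\<^esub> x" by (rule Q.normal_quotient_hom[OF SQ])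
  note q_one = Q.normal_quotient_eq_one[OF SQ]
  have QA_Q: "carrier QA \<subseteq> carrier Q" using RA_iff lcsA by (auto simp: Q_def QA_def)
  have multQ: "x \<otimes>\<^bsub>QA\<^esub> y = x \<otimes>\<^bsub>Q\<^esub> y" for x y by (simp add: Q_def QA_def multA)
  have powQ: "x [^]\<^bsub>Q\<^esub> (i::nat) = x [^]\<^bsub>F\<^esub> i" for x i
    by (simp add: Q_def F.nat_pow_consistent[symmetric])
  interpret h: group_hom QA "Q Mod S" "\<lambda>x. S #>\<^bsub>Q\<^esub> x"
  proof
    show "(\<lambda>x. S #>\<^bsub>Q\<^esub> x) \<in> hom QA (Q Mod S)"
      using QA_Q q.hom_closed q.hom_mult by (intro homI) (auto simp: multQ subset_iff simp del: mult_FactGroup)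
  qed
  \<comment> \<open>Injectivity comes from the retraction: it fixes elements of \<open>A\<close> and
    carries \<open>S\<close> into \<open>SA\<close>.\<close>
  have ker: "kernel QA (Q Mod S) (\<lambda>x. S #>\<^bsub>Q\<^esub> x) = SA"
  proof -
    have "SA \<subseteq> carrier QA"
    proof
      fix x assume x: "x \<in> SA"
      then have "x \<in> carrier A" using subgroup.subset[OF normal_imp_subgroup[OF SAN]] by blast
      moreover have "x \<in> R \<inter> lcs F c" using x SA_S S_sub by blast
      ultimately show "x \<in> carrier QA" using \<epsilon>_id \<epsilon>_lcs by (force simp: QA_def RA_iff)
    qed
    moreover have "x \<in> SA" if "x \<in> carrier QA" "x \<in> S" for x
      using that \<epsilon>_id[of x] \<epsilon>S by (force simp: QA_def RA_iff)
    ultimately have "SA = {x \<in> carrier QA. x \<in> S}" using SA_S by blast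
    also have "\<dots> = {x \<in> carrier QA. S #>\<^bsub>Q\<^esub> x = \<one>\<^bsub>Q Mod S\<^esub>}"
      using QA_Q q_one by blast
    finally show ?thesis by (simp add: kernel_def)
  qed
  have img: "(\<lambda>x. S #>\<^bsub>Q\<^esub> x) ` carrier QA = {z \<in> carrier (Q Mod S). \<exists>j. q.H.ord z = p ^ j}"
  proof (intro equalityI subsetI)
    fix z assume "z \<in> (\<lambda>x. S #>\<^bsub>Q\<^esub> x) ` carrier QA"
    then obtain x where x: "x \<in> carrier QA" "z = S #>\<^bsub>Q\<^esub> x" by blast
    have "g [^]\<^bsub>K\<^esub> (p ^ a) = \<one>\<^bsub>K\<^esub>" if "g \<in> carrier K" for g
      using K.pow_order_eq_1[OF that] assms(8) by (simp add: K_def order_def a_def)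
    \<comment> \<open>The order of \<open>P\<close> is an exponent for \<open>K\<close>, so every
      class coming from \<open>A\<close> has \<open>p\<close>-power order.\<close>
    then obtain j where "x [^]\<^bsub>A\<^esub> ((p ^ a) ^ j) \<in> SA"
      using K.lcs_pres_F_torsion[OF kK, of "p ^ a" x c] x(1)
      unfolding A_def SA_def RA_def QA_def by auto
    then have "x [^]\<^bsub>QA\<^esub> ((p ^ a) ^ j) \<in> kernel QA (Q Mod S) (\<lambda>x. S #>\<^bsub>Q\<^esub> x)"
      unfolding ker by (simp add: QA_def A.nat_pow_consistent[symmetric])
    then have "z [^]\<^bsub>Q Mod S\<^esub> (p ^ (a * j)) = \<one>\<^bsub>Q Mod S\<^esub>"
      using x by (simp add: kernel_def h.hom_nat_pow power_mult del: one_FactGroup)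
    then have "q.H.ord z dvd p ^ (a * j)" using x q.H.pow_eq_id h.hom_closed by blast
    then show "z \<in> {z \<in> carrier (Q Mod S). \<exists>j. q.H.ord z = p ^ j}"
      using x h.hom_closed divides_primepow_nat[OF assms(6)] by blast
  next
    fix z assume "z \<in> {z \<in> carrier (Q Mod S). \<exists>j. q.H.ord z = p ^ j}"
    then obtain j where z: "z \<in> carrier (Q Mod S)" "q.H.ord z = p ^ j" by blast
    then obtain x where x: "x \<in> carrier Q" "z = S #>\<^bsub>Q\<^esub> x"
      by (auto simp: FactGroup_def RCOSETS_def)
    have "z [^]\<^bsub>Q Mod S\<^esub> (p ^ j) = \<one>\<^bsub>Q Mod S\<^esub>" using q.H.pow_ord_eq_1[OF z(1)] z(2) by simp
    then have "S #>\<^bsub>Q\<^esub> (x [^]\<^bsub>Q\<^esub> (p ^ j)) = \<one>\<^bsub>Q Mod S\<^esub>"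
      using x by (simp add: q.hom_nat_pow del: one_FactGroup)
    then have "x [^]\<^bsub>F\<^esub> (p ^ j) \<in> S" using q_one x(1) Q.nat_pow_closed unfolding powQ[symmetric] by blast
    then have y: "inv\<^bsub>F\<^esub> x \<otimes>\<^bsub>F\<^esub> \<epsilon> x \<in> S" using key x(1) by (simp add: Q_def)
    have xF: "x \<in> carrier F" using x(1) lcsFc by (auto simp: Q_def)
    have \<epsilon>x: "\<epsilon> x \<in> carrier QA" using x(1) \<epsilon>R \<epsilon>_lcs by (auto simp: Q_def QA_def)
    have yQ: "inv\<^bsub>F\<^esub> x \<otimes>\<^bsub>F\<^esub> \<epsilon> x \<in> carrier Q" using y S_sub by (auto simp: Q_def)
    \<comment> \<open>A class of \<open>p\<close>-power order is unchanged by the retraction, so it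
      is represented by a word over \<open>P\<close>.\<close>
    have "\<epsilon> x = x \<otimes>\<^bsub>Q\<^esub> (inv\<^bsub>F\<^esub> x \<otimes>\<^bsub>F\<^esub> \<epsilon> x)" using xF by (simp add: Q_def)
    then have "S #>\<^bsub>Q\<^esub> \<epsilon> x = (S #>\<^bsub>Q\<^esub> x) \<otimes>\<^bsub>Q Mod S\<^esub> (S #>\<^bsub>Q\<^esub> (inv\<^bsub>F\<^esub> x \<otimes>\<^bsub>F\<^esub> \<epsilon> x))"
      using q.hom_mult[OF x(1) yQ] by metis
    also have "\<dots> = z" using q_one[OF yQ] y z(1) x(2) q.H.r_one by metis
    finally show "z \<in> (\<lambda>x. S #>\<^bsub>Q\<^esub> x) ` carrier QA" using \<epsilon>x by blast
  qed

  let ?I = "(Q Mod S)\<lparr>carrier := (\<lambda>x. S #>\<^bsub>Q\<^esub> x) ` carrier QA\<rparr>"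
  have "group_hom QA ?I (\<lambda>x. S #>\<^bsub>Q\<^esub> x)"
    using q.H.subgroup_imp_group[OF h.img_is_subgroup] h.homh QA.group_axioms
    by (auto simp: group_hom_def group_hom_axioms_def hom_def)
  then have "QA Mod kernel QA ?I (\<lambda>x. S #>\<^bsub>Q\<^esub> x) \<cong> ?I"
    by (rule group_hom.FactGroup_iso) simp
  moreover have "kernel QA ?I (\<lambda>x. S #>\<^bsub>Q\<^esub> x) = SA"
    using ker by (simp add: kernel_def)
  ultimately have iso: "QA Mod SA \<cong> ?I" by simp
  have "SA \<lhd> QA" using h.normal_kernel ker by simp
  \<comment> \<open>The first isomorphism theorem leads from the quotient to the image; the claim is
    the reverse direction.\<close>
  then have "?I \<cong> QA Mod SA"
    using iso by (intro group.iso_sym[OF normal.factorgroup_is_group])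
  moreover have "sylow_part p (baer_invariant c G) = ?I"
    unfolding sylow_part_def baer_invariant_def img
    by (simp add: Q_def S_def F_def R_def)
  moreover have "baer_invariant c (G\<lparr>carrier := P\<rparr>) = QA Mod SA"
    by (simp add: baer_invariant_def QA_def SA_def A_def RA_def K_def)
  ultimately show ?thesis by simp
qed

end
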